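(* Let $A=\mathbb{Q}\cdot1_A\oplus\mathbb{Q}\cdot a$ with $a^2=0$. (a) The set of orders in $A$ is $\{\mathbb{Z}\cdot1_A+\mathbb{Z}\cdot\alpha a : \alpha\in\mathbb{Q}_{>0}\}$. (b) Each full lattice $L$ in $A$ has a unique $\mathbb{Z}$-basis $$(1_A,a)\begin{pmatrix}\beta_{11}&0\\\beta_{21}&\beta_{22}\end{pmatrix}\quad\text{with }\beta_{11},\beta_{22}\in\mathbb{Q}_{>0},\ \beta_{21}\in(-\tfrac12\beta_{22},\tfrac12\beta_{22}]\cap\mathbb{Q}.$$ Its $\varepsilon$-class contains the order $\mathbb{Z}\cdot1_A+\mathbb{Z}\cdot\frac{\beta_{22}}{\beta_{11}}a$ and no other order. So $L$ is invertible and $\mathcal{O}(L)=\mathbb{Z}\cdot1_A+\mathbb{Z}\cdot\frac{\beta_{22}}{\beta_{11}}a$. The semigroup structure on $\mathcal{E}(A)=W(\mathcal{E}(A))$ is $$(\mathcal{E}(A),\cdot)\cong(\{\text{orders in }A\},\cdot)\cong(\mathbb{Q}_{>0},{\gcd}_{\mathbb{Q}})\cong(\{\mathbb{Z}\text{-lattices}\neq0\text{ in }\mathbb{Q}\},+).$$ (c) Let $\Lambda_a:=\mathbb{Z}\cdot1_A+\mathbb{Z}\cdot a$. The set of orders which contain $\Lambda_a$ is $\{\mathbb{Z}\cdot1_A+\mathbb{Z}\cdot\frac1m a : m\in\mathbb{N}\}$, with semigroup structure isomorphic to $$\bigl(\{\tfrac1m : m\in\mathbb{N}\},{\gcd}_{\mathbb{Q}}\bigr)\xrightarrow{\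 \cong\ }(\mathbb{N},\operatorname{lcm}),\quad\tfrac1m\mapsto m.$$ (d) Each $GL_2(\mathbb{Z})$-conjugacy class of nilpotent integer $2\times2$ matrices $\neq0$ has a unique representative $\begin{pmatrix}0&m\\0&0\end{pmatrix}$ with $m\in\mathbb{N}$. It comes from the $\varepsilon$-class of full lattices which contains the order $\mathbb{Z}\cdot1_A+\mathbb{Z}\cdot\frac1m a$.
   Context: $\mathbb{N}=\{1,2,\dots\}$. For a tuple $\underline{v}$ of vectors and a matrix $M=(m_{ij})$, $\underline{v}\cdot M$ is the tuple with $j$-th entry $\sum_im_{ij}v_i$. A full lattice in $A$ is a finitely generated $\mathbb{Z}$-submodule generating $A$ over $\mathbb{Q}$; $\mathcal{L}(A)$ is the set of full lattices, a commutative semigroup with $L_1L_2=\{\text{finite sums }\sum a_ib_i: a_i\in L_1,b_i\in L_2\}$. An order is a full lattice $\Lambda$ with $1_A\in\Lambda$, $\Lambda\Lambda\subset\Lambda$; the orders form a subsemigroup. $\mathcal{O}(L)=\{x\in A:xL\subset L\}$. An element $s$ of a commutative semigroup is invertible if there are elements $b,c$ with $sb=c$, $sc=s$. Full lattices are $\varepsilon$-equivalent if $L_2=uL_1$ for a unit $u$ of $A$; $\mathcal{E}(A)$ is the quotient semigroup of $\varepsilon$-classes. In a commutative semigroup $S$, $s_1\sim_ws_2$ if $s_1=s_2$ or there are $x_1,x_2\in S$ with $s_1x_1=s_2$, $s_2x_2=s_1$; $W(S)=S/\!\sim_w$, and $W(\mathcal{E}(A))=\mathcal{E}(A)$ means that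 each $w$-class in $\mathcal{E}(A)$ has one element. For $q_1,q_2\in\mathbb{Q}_{>0}$, $\gcd_{\mathbb{Q}}(q_1,q_2)\in\mathbb{Q}_{>0}$ is defined by $\mathbb{Z}q_1+\mathbb{Z}q_2=\mathbb{Z}\gcd_{\mathbb{Q}}(q_1,q_2)$. An $\varepsilon$-class $[L]_\varepsilon$ with $\mathcal{O}(L)\supset\Lambda_a$ gives the $GL_2(\mathbb{Z})$-conjugacy class of the matrices $M\in M_{2\times2}(\mathbb{Z})$ with $(ab_1,ab_2)=(b_1,b_2)\cdot M$, $(b_1,b_2)$ a $\mathbb{Z}$-basis of $L$; "comes from" refers to this. *)

theory Defs
  imports "HOL-Analysis.Cartesian_Space"
begin

text \<open>
  A commutative \<open>\<rat>\<close>-algebra with unit is a type of class \<open>comm_ring_1\<close> together with a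
  scalar multiplication by rationals.
\<close>

locale rat_algebra = vector_space smul
  for smul :: "rat \<Rightarrow> 'a::comm_ring_1 \<Rightarrow> 'a" +
  assumes smul_mult_left: "smul q x * y = smul q (x * y)"

abbreviation int_scale :: "int \<Rightarrow> 'a::comm_ring_1 \<Rightarrow> 'a" where
  "int_scale n x \<equiv> of_int n * x"

abbreviation int_span :: "'a::comm_ring_1 set \<Rightarrow> 'a set" where
  "int_span \<equiv> module.span int_scale"

definition tuple_mult :: "('r \<Rightarrow> 'a \<Rightarrow> 'a::comm_monoid_add) \<Rightarrow> 'a^'m \<Rightarrow> 'r^'n^'m \<Rightarrow> 'a^'n" where
  "tuple_mult smul v M = (\<chi> j. \<Sum>i\<in>UNIV. smul (M $ i $ j) (v $ i))"

definition tuple_basis ::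
    "('r::comm_ring_1 \<Rightarrow> 'a::ab_group_add \<Rightarrow> 'a) \<Rightarrow> 'a^'n \<Rightarrow> 'a set \<Rightarrow> bool" where
  "tuple_basis smul v L \<longleftrightarrow>
     inj (($) v) \<and> \<not> module.dependent smul (range (($) v)) \<and> module.span smul (range (($) v)) = L"


section \<open>Commutative semigroups\<close>

text \<open>
  A semigroup is given by a carrier set and an operation; the semigroups of interest have no
  neutral element in general.
\<close>

definition comm_semigroup_on :: "'s set \<Rightarrow> ('s \<Rightarrow> 's \<Rightarrow> 's) \<Rightarrow> bool" where
  "comm_semigroup_on S f \<longleftrightarrow>
     (\<forall>x\<in>S. \<forall>y\<in>S. f x y \<in> S \<and> f x y = f y x) \<and>
     (\<forall>x\<in>S. \<forall>y\<in>S. \<forall>z\<in>S. f (f x y) z = f x (f y z))"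

definition semigroup_iso ::
    "('s \<Rightarrow> 't) \<Rightarrow> 's set \<Rightarrow> ('s \<Rightarrow> 's \<Rightarrow> 's) \<Rightarrow> 't set \<Rightarrow> ('t \<Rightarrow> 't \<Rightarrow> 't) \<Rightarrow> bool" where
  "semigroup_iso h S f T g \<longleftrightarrow>
     comm_semigroup_on S f \<and> comm_semigroup_on T g \<and>
     bij_betw h S T \<and> (\<forall>x\<in>S. \<forall>y\<in>S. h (f x y) = g (h x) (h y))"

definition semigroup_isomorphic ::
    "'s set \<Rightarrow> ('s \<Rightarrow> 's \<Rightarrow> 's) \<Rightarrow> 't set \<Rightarrow> ('t \<Rightarrow> 't \<Rightarrow> 't) \<Rightarrow> bool" where
  "semigroup_isomorphic S f T g \<longleftrightarrow> (\<exists>h. semigroup_iso h S f T g)"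

definition semigroup_invertible :: "'s set \<Rightarrow> ('s \<Rightarrow> 's \<Rightarrow> 's) \<Rightarrow> 's \<Rightarrow> bool" where
  "semigroup_invertible S f s \<longleftrightarrow> s \<in> S \<and> (\<exists>b\<in>S. \<exists>c\<in>S. f s b = c \<and> f c s = s)"

definition w_rel :: "'s set \<Rightarrow> ('s \<Rightarrow> 's \<Rightarrow> 's) \<Rightarrow> ('s \<times> 's) set" where
  "w_rel S f = {(s1, s2). s1 \<in> S \<and> s2 \<in> S \<and>
     (s1 = s2 \<or> (\<exists>x1\<in>S. \<exists>x2\<in>S. f s1 x1 = s2 \<and> f s2 x2 = s1))}"

definition w_classes :: "'s set \<Rightarrow> ('s \<Rightarrow> 's \<Rightarrow> 's) \<Rightarrow> 's set set" where
  "w_classes S f = S // w_rel S f"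


section \<open>Full lattices, orders and \<open>\<epsilon>\<close>-classes\<close>

definition fin_gen_int :: "'a::comm_ring_1 set \<Rightarrow> bool" where
  "fin_gen_int L \<longleftrightarrow> (\<exists>B. finite B \<and> L = int_span B)"

definition full_lattices :: "(rat \<Rightarrow> 'a::comm_ring_1 \<Rightarrow> 'a) \<Rightarrow> 'a set set" where
  "full_lattices smul = {L. fin_gen_int L \<and> module.span smul L = UNIV}"

definition lattice_mult :: "'a::comm_ring_1 set \<Rightarrow> 'a set \<Rightarrow> 'a set" where
  "lattice_mult L1 L2 =
     {(\<Sum>i<n. x i * y i) | (n::nat) x y. \<forall>i<n. x i \<in> L1 \<and> y i \<in> L2}"

definition orders :: "(rat \<Rightarrow> 'a::comm_ring_1 \<Rightarrow> 'a) \<Rightarrow> 'a set set" where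
  "orders smul = {\<Lambda> \<in> full_lattices smul. 1 \<in> \<Lambda> \<and> lattice_mult \<Lambda> \<Lambda> \<subseteq> \<Lambda>}"

definition order_of :: "'a::comm_ring_1 set \<Rightarrow> 'a set" where
  "order_of L = {x. (*) x ` L \<subseteq> L}"

definition eps_rel :: "(rat \<Rightarrow> 'a::comm_ring_1 \<Rightarrow> 'a) \<Rightarrow> ('a set \<times> 'a set) set" where
  "eps_rel smul = {(L1, L2). L1 \<in> full_lattices smul \<and> L2 \<in> full_lattices smul \<and>
     (\<exists>u. u dvd 1 \<and> L2 = (*) u ` L1)}"

definition eps_class :: "(rat \<Rightarrow> 'a::comm_ring_1 \<Rightarrow> 'a) \<Rightarrow> 'a set \<Rightarrow> 'a set set" where
  "eps_class smul L = eps_rel smul `` {L}"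

definition eps_classes :: "(rat \<Rightarrow> 'a::comm_ring_1 \<Rightarrow> 'a) \<Rightarrow> 'a set set set" where
  "eps_classes smul = full_lattices smul // eps_rel smul"

text \<open>The union below is over equal classes, as the product respects \<open>\<epsilon>\<close>-equivalence.\<close>

definition eps_mult ::
    "(rat \<Rightarrow> 'a::comm_ring_1 \<Rightarrow> 'a) \<Rightarrow> 'a set set \<Rightarrow> 'a set set \<Rightarrow> 'a set set" where
  "eps_mult smul C D = (\<Union>L\<in>C. \<Union>M\<in>D. eps_class smul (lattice_mult L M))"


section \<open>Rational numbers\<close>

definition gcd_rat :: "rat \<Rightarrow> rat \<Rightarrow> rat" where
  "gcd_rat q1 q2 = (THE d. 0 < d \<and> int_span {q1, q2} = int_span {d})"

definition rat_lattices :: "rat set set" where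
  "rat_lattices = {L. fin_gen_int L \<and> L \<noteq> {0}}"

definition lattice_add :: "rat set \<Rightarrow> rat set \<Rightarrow> rat set" where
  "lattice_add L1 L2 = {x + y | x y. x \<in> L1 \<and> y \<in> L2}"


section \<open>Integer matrices\<close>

text \<open>The power operation on the matrix type is componentwise, so powers are iterated products.\<close>

definition nilpotent_mat :: "int^'n^'n \<Rightarrow> bool" where
  "nilpotent_mat M \<longleftrightarrow> (\<exists>k::nat. (((**) M) ^^ k) (mat 1) = 0)"

definition conj_class :: "int^'n^'n \<Rightarrow> (int^'n^'n) set" where
  "conj_class M = {matrix_inv P ** M ** P | P. invertible P}"

text \<open>
  The conjugacy class \<open>C\<close> comes from the \<open>\<epsilon>\<close>-class \<open>E\<close>: multiplication by \<open>a\<close> on the members of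
  \<open>E\<close>, which are modules over \<open>\<int>1 + \<int>a\<close>, has as its matrices with respect to
  \<open>\<int>\<close>-bases the elements of \<open>C\<close>.
\<close>

definition comes_from ::
    "(rat \<Rightarrow> 'a::comm_ring_1 \<Rightarrow> 'a) \<Rightarrow> 'a \<Rightarrow> (int^2^2) set \<Rightarrow> 'a set set \<Rightarrow> bool" where
  "comes_from smul a C E \<longleftrightarrow> E \<in> eps_classes smul \<and>
     (\<forall>L\<in>E. int_span {1, a} \<subseteq> order_of L \<and>
        C = {M. \<exists>b::'a^2. tuple_basis int_scale b L \<and>
                  (\<chi> j. a * b $ j) = tuple_mult int_scale b M})"

end

theory Submission
  imports Defs
begin

text \<open>
  Write elements of \<open>A\<close> as \<open>p + q a\<close>, so that \<open>(p + q a) (r + s a) = p r + (p s + q r) a\<close> and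
  \<open>p + q a\<close> is a unit exactly when \<open>p \<noteq> 0\<close>. Everything rests on one observation: every full
  lattice is a unit times an order \<open>\<int> + \<int> \<alpha> a\<close>. Indeed, a full lattice has a triangular basis
  \<open>p + r a\<close>, \<open>q a\<close>, where \<open>p\<close> generates the projection to the first coordinate and \<open>q\<close>
  generates the intersection with \<open>\<rat> a\<close> (\<open>full_lattice_form\<close>). The first basis vector is a unit,
  and because \<open>a\<^sup>2 = 0\<close> it multiplies \<open>\<alpha> a\<close> like the scalar \<open>p\<close>, so the lattice is
  \<open>(p + r a) (\<int> + \<int> (q / p) a)\<close> (\<open>scaled_ord_lat\<close>).

  The multiplier ring \<open>\<O>(L)\<close> is unchanged when \<open>L\<close> is multiplied by a unit, and an order is its
  own multiplier ring. Hence \<open>q / p\<close> is a complete invariant of the \<open>\<epsilon>\<close>-class, each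
  \<open>\<epsilon>\<close>-class contains exactly one order, and every order has the form \<open>\<int> + \<int> \<alpha> a\<close>. The
  product of two such orders is \<open>\<int> + (\<int> \<alpha> + \<int> \<beta>) a\<close>, whose parameter is the rational greatest
  common divisor of \<open>\<alpha>\<close> and \<open>\<beta>\<close> (\<open>lattice_mult_ord_lat\<close>). All the semigroups are therefore
  images of the positive rationals with \<open>gcd_rat\<close>, and facts such as the triviality of
  \<open>w\<close>-equivalence are checked there once.

  For matrices, a nilpotent integer matrix of size two has a primitive kernel vector; completing it
  to a basis of \<open>\<int>\<^sup>2\<close> conjugates the matrix to one with a single entry \<open>m\<close> in the upper right
  corner, and \<open>\<bar>m\<bar>\<close> is the greatest common divisor of the entries of any conjugate
  (\<open>nilpotent_mat2_normal_form\<close>). With respect to the basis \<open>a / m\<close>, \<open>1\<close> of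
  \<open>\<int> + \<int> (1 / m) a\<close>, multiplication by \<open>a\<close> has exactly this matrix; other bases of the lattice
  give its conjugates (\<open>matrices_of_mult_conj_class\<close>), and multiplying the lattice by a unit does
  not change the matrices.
\<close>


section \<open>Commutative semigroups\<close>

text \<open>Closure, commutativity and associativity all transfer to the target, because every
  element of the target is an image.\<close>

lemma semigroup_isoI:
  assumes S: "comm_semigroup_on S f" and h: "bij_betw h S T"
    and hom: "\<And>x y. x \<in> S \<Longrightarrow> y \<in> S \<Longrightarrow> g (h x) (h y) = h (f x y)"
  shows "semigroup_iso h S f T g"
proof -
  have T: "T = h ` S"
    using h by (simp add: bij_betw_def)
  have cl: "f x y \<in> S" if "x \<in> S" "y \<in> S" for x y
    using S that by (auto simp: comm_semigroup_on_def)
  have "comm_semigroup_on T g"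
    using S unfolding comm_semigroup_on_def T by (auto simp: hom cl)
  then show ?thesis
    using S h by (simp add: semigroup_iso_def hom)
qed

lemma comm_semigroup_on_subset:
  assumes "comm_semigroup_on S f" "T \<subseteq> S" "\<And>x y. x \<in> T \<Longrightarrow> y \<in> T \<Longrightarrow> f x y \<in> T"
  shows "comm_semigroup_on T f"
proof -
  have S: "f x y = f y x" "f (f x y) z = f x (f y z)" if "x \<in> T" "y \<in> T" "z \<in> T" for x y z
    using assms(1) that[THEN subsetD[OF assms(2)]] unfolding comm_semigroup_on_def by blast+
  then show ?thesis
    unfolding comm_semigroup_on_def using assms(3) by blast
qed

lemma semigroup_isomorphicI: "semigroup_iso h S f T g \<Longrightarrow> semigroup_isomorphic S f T g"
  by (auto simp: semigroup_isomorphic_def)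

lemma semigroup_isomorphic_sym:
  assumes "semigroup_isomorphic S f T g"
  shows "semigroup_isomorphic T g S f"
proof -
  obtain h where S: "comm_semigroup_on S f" and T: "comm_semigroup_on T g"
    and h: "bij_betw h S T" and hom: "\<And>x y. x \<in> S \<Longrightarrow> y \<in> S \<Longrightarrow> h (f x y) = g (h x) (h y)"
    using assms by (auto simp: semigroup_isomorphic_def semigroup_iso_def)
  let ?k = "inv_into S h"
  have k: "bij_betw ?k T S"
    using h by (rule bij_betw_inv_into)
  have "f (?k x) (?k y) = ?k (g x y)" if "x \<in> T" "y \<in> T" for x y
  proof -
    have mem: "?k x \<in> S" "?k y \<in> S"
      using k that by (auto simp: bij_betw_def)
    then have "f (?k x) (?k y) \<in> S"
      using S by (auto simp: comm_semigroup_on_def)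
    moreover have "h (f (?k x) (?k y)) = g x y"
      using hom[OF mem] that h by (simp add: bij_betw_inv_into_right)
    ultimately show ?thesis
      using h by (metis bij_betw_inv_into_left)
  qed
  then show ?thesis
    using semigroup_isoI[OF T k] semigroup_isomorphicI by blast
qed

lemma semigroup_isomorphic_trans:
  assumes "semigroup_isomorphic S f T g" "semigroup_isomorphic T g U k"
  shows "semigroup_isomorphic S f U k"
proof -
  obtain h h' where S: "comm_semigroup_on S f" and U: "comm_semigroup_on U k"
    and h: "bij_betw h S T" "\<forall>x\<in>S. \<forall>y\<in>S. h (f x y) = g (h x) (h y)"
    and h': "bij_betw h' T U" "\<forall>x\<in>T. \<forall>y\<in>T. h' (g x y) = k (h' x) (h' y)"
    using assms by (auto simp: semigroup_isomorphic_def semigroup_iso_def)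
  have "\<forall>x\<in>S. h x \<in> T"
    using h(1) by (auto simp: bij_betw_def)
  then have "semigroup_iso (h' \<circ> h) S f U k"
    using S U h h' by (auto simp: semigroup_iso_def intro: bij_betw_trans)
  then show ?thesis
    by (rule semigroup_isomorphicI)
qed

text \<open>Isomorphisms preserve and reflect \<open>w\<close>-equivalence, which is mutual divisibility; so it is
  enough to see in one isomorphic copy that mutual divisibility implies equality.\<close>

lemma w_classes_singleton_iso:
  assumes iso: "semigroup_iso h S f T g"
    and anti: "\<And>x y u v. x \<in> S \<Longrightarrow> y \<in> S \<Longrightarrow> u \<in> S \<Longrightarrow> v \<in> S \<Longrightarrow>
                 f x u = y \<Longrightarrow> f y v = x \<Longrightarrow> x = y"
    and C: "C \<in> w_classes T g"
  shows "is_singleton C"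
proof -
  have h: "bij_betw h S T" and hom: "\<And>x y. x \<in> S \<Longrightarrow> y \<in> S \<Longrightarrow> h (f x y) = g (h x) (h y)"
    and S: "comm_semigroup_on S f"
    using iso by (auto simp: semigroup_iso_def)
  have T: "T = h ` S" and inj: "inj_on h S"
    using h by (auto simp: bij_betw_def)
  have cl: "f x y \<in> S" if "x \<in> S" "y \<in> S" for x y
    using S that by (auto simp: comm_semigroup_on_def)
  have "s = t" if "(s, t) \<in> w_rel T g" for s t
  proof (rule ccontr)
    assume "s \<noteq> t"
    with that obtain x y u v where *: "x \<in> S" "y \<in> S" "u \<in> S" "v \<in> S" "s = h x" "t = h y"
      "g (h x) (h u) = h y" "g (h y) (h v) = h x"
      by (auto simp: w_rel_def T)
    then have "h (f x u) = h y" "h (f y v) = h x"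
      by (simp_all add: hom)
    then have "f x u = y" "f y v = x"
      using inj * cl by (simp_all add: inj_on_eq_iff)
    then show False
      using anti[of x y u v] * \<open>s \<noteq> t\<close> by simp
  qed
  moreover obtain s where s: "s \<in> T" "C = w_rel T g `` {s}"
    using C by (auto simp: w_classes_def elim: quotientE)
  moreover have "(s, s) \<in> w_rel T g"
    using s by (simp add: w_rel_def)
  ultimately have "C = {s}"
    by blast
  then show ?thesis
    by simp
qed


section \<open>Spans and bases\<close>

interpretation int_mod: module "int_scale :: int \<Rightarrow> 'a::comm_ring_1 \<Rightarrow> 'a"
  by unfold_locales (auto simp: algebra_simps)

lemma (in module) span_pair: "span {x, y} = {scale m x + scale n y | m n. True}"
proof -
  have "z \<in> span {x, y} \<longleftrightarrow> (\<exists>m n. z = scale m x + scale n y)" for z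
    by (simp add: span_insert[of x] span_singleton image_iff diff_eq_eq add.commute)
  then show ?thesis
    by blast
qed

lemma (in module) span_insert_cong: "span S = span T \<Longrightarrow> span (insert x S) = span (insert x T)"
  by (simp add: span_insert)

context module
begin

lemma coordinates_diff:
  "(\<Sum>i\<in>UNIV. scale ((c - d :: 'a^'n) $ i) (v $ i)) =
    (\<Sum>i\<in>UNIV. scale (c $ i) (v $ i)) - (\<Sum>i\<in>UNIV. scale (d $ i) (v $ i))"
  by (simp add: scale_left_diff_distrib sum_subtractf)

lemma coordinates_axis: "(\<Sum>i\<in>UNIV. scale (axis j (1::'a) $ i) (v $ i)) = v $ (j::'n::finite)"
proof -
  have "(\<Sum>i\<in>UNIV. scale (axis j (1::'a) $ i) (v $ i)) = (\<Sum>i\<in>UNIV. if i = j then v $ i else 0)"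
    by (intro sum.cong) (auto simp: axis_def)
  then show ?thesis
    by simp
qed

lemma span_range_tuple:
  "span (range (($) v)) = range (\<lambda>c::'a^'n::finite. \<Sum>i\<in>UNIV. scale (c $ i) (v $ i))"
  (is "_ = range ?f")
proof
  have "subspace (range ?f)"
  proof (rule subspaceI)
    show "0 \<in> range ?f"
      by (rule image_eqI[of _ _ 0]) auto
    show "x + y \<in> range ?f" if "x \<in> range ?f" "y \<in> range ?f" for x y
    proof -
      from that obtain c d where "x = ?f c" "y = ?f d"
        by auto
      then have "x + y = ?f (c + d)"
        by (simp add: scale_left_distrib sum.distrib)
      then show ?thesis
        by blast
    qed
    show "scale k x \<in> range ?f" if "x \<in> range ?f" for k x
    proof -
      from that obtain c where "x = ?f c"
        by auto
      then have "scale k x = ?f (\<chi> i. k * c $ i)"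
        by (simp add: scale_sum_right)
      then show ?thesis
        by blast
    qed
  qed
  moreover have "v $ j \<in> range ?f" for j
    by (rule range_eqI[of _ _ "axis j 1"]) (simp only: coordinates_axis)
  ultimately show "span (range (($) v)) \<subseteq> range ?f"
    by (intro span_minimal) auto
  show "range ?f \<subseteq> span (range (($) v))"
    by (auto intro!: span_sum span_scale intro: span_base)
qed

text \<open>The coordinate map of a tuple is injective exactly when the tuple is repetition-free and
  independent; stating this together with its image makes changes of basis a matter of composing
  bijections.\<close>

lemma tuple_basis_iff_bij_betw:
  fixes v :: "'b^'n::finite"
  shows "tuple_basis scale v L \<longleftrightarrow>
    bij_betw (\<lambda>c::'a^'n. \<Sum>i\<in>UNIV. scale (c $ i) (v $ i)) UNIV L"
    (is "_ \<longleftrightarrow> bij_betw ?f UNIV L")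
proof -
  have "inj (($) v) \<and> \<not> dependent (range (($) v)) \<longleftrightarrow> inj ?f"
  proof
    assume v: "inj (($) v) \<and> \<not> dependent (range (($) v))"
    show "inj ?f"
    proof (rule injI)
      fix c d :: "'a^'n"
      assume "?f c = ?f d"
      then have *: "(\<Sum>i\<in>UNIV. scale ((c - d) $ i) (v $ i)) = 0"
        by (simp only: coordinates_diff) simp
      define u where "u x = (c - d) $ inv (($) v) x" for x
      have u: "u (v $ i) = (c - d) $ i" for i
        using v by (simp add: u_def)
      have "(\<Sum>x\<in>range (($) v). scale (u x) x) = 0"
        using v * by (simp add: sum.reindex u)
      then have "\<forall>x\<in>range (($) v). u x = 0"
        using v by (auto simp: dependent_finite)
      then show "c = d"
        by (simp add: u vec_eq_iff)
    qed
  next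
    assume f: "inj ?f"
    have inj: "inj (($) v)"
    proof (rule injI)
      fix i j
      assume "v $ i = v $ j"
      then have "?f (axis i 1) = ?f (axis j 1)"
        by (simp add: coordinates_axis)
      then have "axis i (1::'a) = axis j 1"
        by (rule injD[OF f])
      then show "i = j"
        by (simp add: axis_eq_axis)
    qed
    have zero: "u x = 0" if "(\<Sum>x\<in>range (($) v). scale (u x) x) = 0" "x \<in> range (($) v)" for u x
    proof -
      have "?f (\<chi> i. u (v $ i)) = ?f 0"
        using that inj by (simp add: sum.reindex)
      then have "(\<chi> i. u (v $ i)) = 0"
        by (rule injD[OF f])
      then show ?thesis
        using that by (auto simp: vec_eq_iff)
    qed
    have "\<not> dependent (range (($) v))"
    proof
      assume "dependent (range (($) v))"
      then obtain u x where "x \<in> range (($) v)" "u x \<noteq> 0" "(\<Sum>x\<in>range (($) v). scale (u x) x) = 0"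
        by (subst (asm) dependent_finite) auto
      then show False
        using zero[of u x] by simp
    qed
    with inj show "inj (($) v) \<and> \<not> dependent (range (($) v))" ..
  qed
  then show ?thesis
    unfolding tuple_basis_def bij_betw_def span_range_tuple conj_assoc[symmetric] by (simp only:)
qed

lemma tuple_basis_2_iff:
  fixes v :: "'b^2"
  shows "tuple_basis scale v L \<longleftrightarrow> span {v $ 1, v $ 2} = L \<and>
    (\<forall>m n. scale m (v $ 1) + scale n (v $ 2) = 0 \<longrightarrow> m = 0 \<and> n = 0)"
proof -
  let ?f = "\<lambda>c::'a^2. \<Sum>i\<in>UNIV. scale (c $ i) (v $ i)"
  have "inj ?f \<longleftrightarrow> (\<forall>c. ?f c = 0 \<longrightarrow> c = 0)"
  proof
    assume "inj ?f"
    then show "\<forall>c. ?f c = 0 \<longrightarrow> c = 0"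
      using injD[of ?f _ 0] by simp
  next
    assume *: "\<forall>c. ?f c = 0 \<longrightarrow> c = 0"
    show "inj ?f"
    proof (rule injI)
      fix c d
      assume "?f c = ?f d"
      then have "?f (c - d) = 0"
        by (simp only: coordinates_diff) simp
      then show "c = d"
        using * by (metis eq_iff_diff_eq_0)
    qed
  qed
  also have "\<dots> \<longleftrightarrow> (\<forall>m n. scale m (v $ 1) + scale n (v $ 2) = 0 \<longrightarrow> m = 0 \<and> n = 0)"
    by (simp add: sum_2 forall_vector_2 vec_eq_iff forall_2)
  finally have inj: "inj ?f \<longleftrightarrow> (\<forall>m n. scale m (v $ 1) + scale n (v $ 2) = 0 \<longrightarrow> m = 0 \<and> n = 0)" .
  have "range (($) v) = {v $ 1, v $ 2}"
    by (simp add: UNIV_2)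
  then have range: "range ?f = span {v $ 1, v $ 2}"
    by (simp only: span_range_tuple[symmetric])
  show ?thesis
    unfolding tuple_basis_iff_bij_betw bij_betw_def inj range by (rule conj_commute)
qed

lemma tuple_mult_mat_1:
  "tuple_mult scale v (mat 1) = v"
proof -
  have "(\<Sum>i\<in>UNIV. scale (mat 1 $ i $ j) (v $ i)) = v $ j" for j
    using coordinates_axis[of j v] by (simp add: mat_def axis_def)
  then show ?thesis
    by (simp add: tuple_mult_def vec_eq_iff)
qed

lemma coordinates_tuple_mult:
  "(\<Sum>j\<in>UNIV. scale (c $ j) (tuple_mult scale v M $ j)) =
    (\<Sum>i\<in>UNIV. scale ((M *v c) $ i) (v $ i))"
proof -
  have "(\<Sum>j\<in>UNIV. scale (c $ j) (tuple_mult scale v M $ j)) =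
      (\<Sum>j\<in>UNIV. \<Sum>i\<in>UNIV. scale (c $ j * M $ i $ j) (v $ i))"
    by (simp add: tuple_mult_def scale_sum_right)
  also have "\<dots> = (\<Sum>i\<in>UNIV. \<Sum>j\<in>UNIV. scale (c $ j * M $ i $ j) (v $ i))"
    by (rule sum.swap)
  also have "\<dots> = (\<Sum>i\<in>UNIV. scale ((M *v c) $ i) (v $ i))"
    by (simp add: matrix_vector_mult_def scale_sum_left mult.commute)
  finally show ?thesis .
qed

lemma tuple_mult_assoc:
  "tuple_mult scale (tuple_mult scale v M) N = tuple_mult scale v (M ** N)"
proof -
  have "(\<Sum>j\<in>UNIV. scale (N $ j $ k) (tuple_mult scale v M $ j)) =
    (\<Sum>i\<in>UNIV. scale ((M ** N) $ i $ k) (v $ i))" for k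
    using coordinates_tuple_mult[of "\<chi> j. N $ j $ k" v M]
    by (simp add: matrix_vector_mult_def matrix_matrix_mult_def)
  then show ?thesis
    by (simp add: tuple_mult_def[of _ "tuple_mult _ _ _"] tuple_mult_def[of _ _ "M ** N"])
qed

lemma tuple_mult_cancel:
  assumes "tuple_basis scale v L" "tuple_mult scale v M = tuple_mult scale v N"
  shows "M = N"
proof -
  have "inj (\<lambda>c. \<Sum>i\<in>UNIV. scale (c $ i) (v $ i))"
    using assms(1) by (simp add: tuple_basis_iff_bij_betw bij_betw_def)
  moreover have "(\<Sum>i\<in>UNIV. scale ((\<chi> i. M $ i $ j) $ i) (v $ i)) =
    (\<Sum>i\<in>UNIV. scale ((\<chi> i. N $ i $ j) $ i) (v $ i))" for j
    using assms(2) by (simp add: tuple_mult_def vec_eq_iff)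
  ultimately have "(\<chi> i. M $ i $ j) = (\<chi> i. N $ i $ j)" for j
    by (rule injD)
  then show ?thesis
    by (simp add: vec_eq_iff)
qed

text \<open>Two bases express each other by matrices, and these are inverse to one another because
  coordinates are unique; conversely an invertible matrix acts bijectively on coordinate vectors.\<close>

lemma tuple_basis_change:
  fixes v w :: "'b::ab_group_add^'n::finite"
  assumes v: "tuple_basis scale v L"
  shows "tuple_basis scale w L \<longleftrightarrow>
    (\<exists>P Q. P ** Q = mat 1 \<and> Q ** P = mat 1 \<and> w = tuple_mult scale v P)"
proof -
  have ex: "\<exists>P. y = tuple_mult scale x P"
    if x: "tuple_basis scale x L" and y: "tuple_basis scale y L" for x y :: "'b^'n"
  proof -
    have "\<exists>c. y $ j = (\<Sum>i\<in>UNIV. scale (c $ i) (x $ i))" for j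
    proof -
      have "y $ j \<in> span (range (($) x))"
        using x y span_base[of "y $ j" "range (($) y)"] by (simp add: tuple_basis_def)
      then show ?thesis
        unfolding span_range_tuple by blast
    qed
    then have "\<exists>c. \<forall>j. y $ j = (\<Sum>i\<in>UNIV. scale (c j $ i) (x $ i))"
      by (intro choice) blast
    then obtain c where "y $ j = (\<Sum>i\<in>UNIV. scale (c j $ i) (x $ i))" for j
      by blast
    then have "y = tuple_mult scale x (\<chi> i j. c j $ i)"
      by (simp add: tuple_mult_def vec_eq_iff)
    then show ?thesis
      by blast
  qed
  show ?thesis
  proof
    assume w: "tuple_basis scale w L"
    obtain P Q where P: "w = tuple_mult scale v P" and Q: "v = tuple_mult scale w Q"
      using ex[OF v w] ex[OF w v] by blast
    have "tuple_mult scale v (P ** Q) = tuple_mult scale v (mat 1)"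
      unfolding tuple_mult_mat_1 tuple_mult_assoc[symmetric] P[symmetric] Q[symmetric] ..
    moreover have "tuple_mult scale w (Q ** P) = tuple_mult scale w (mat 1)"
      unfolding tuple_mult_mat_1 tuple_mult_assoc[symmetric] P[symmetric] Q[symmetric] ..
    ultimately have "P ** Q = mat 1" "Q ** P = mat 1"
      by (auto dest: tuple_mult_cancel[OF v] tuple_mult_cancel[OF w])
    then show "\<exists>P Q. P ** Q = mat 1 \<and> Q ** P = mat 1 \<and> w = tuple_mult scale v P"
      using P by blast
  next
    assume "\<exists>P Q. P ** Q = mat 1 \<and> Q ** P = mat 1 \<and> w = tuple_mult scale v P"
    then obtain P Q where PQ: "P ** Q = mat 1" "Q ** P = mat 1" and w: "w = tuple_mult scale v P"
      by blast
    have "bij_betw ((*v) P) UNIV UNIV"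
      by (rule bij_betwI[of _ _ _ "(*v) Q"]) (auto simp: matrix_vector_mul_assoc PQ)
    from bij_betw_trans[OF this] show "tuple_basis scale w L"
      using v by (simp add: tuple_basis_iff_bij_betw w coordinates_tuple_mult o_def)
  qed
qed

end


section \<open>Conjugacy classes of integer matrices\<close>

lemma matrix_inv_eq:
  assumes "P ** Q = mat 1" "Q ** P = mat 1"
  shows "matrix_inv P = Q"
proof -
  have "P ** matrix_inv P = mat 1 \<and> matrix_inv P ** P = mat 1"
    unfolding matrix_inv_def by (rule someI[of _ Q]) (simp add: assms)
  then show ?thesis
    using assms by (metis matrix_mul_assoc matrix_mul_lid matrix_mul_rid)
qed

text \<open>The two-sided inverse as an explicit witness is easier to transport than \<open>matrix_inv\<close>.\<close>

lemma conj_class_eq: "conj_class M = {Q ** M ** P | P Q. P ** Q = mat 1 \<and> Q ** P = mat 1}"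
  unfolding conj_class_def invertible_def by (auto simp: matrix_inv_eq) (metis matrix_inv_eq)+

lemma conj_class_sub:
  assumes "N \<in> conj_class M"
  shows "conj_class N \<subseteq> conj_class M"
proof
  fix X
  assume "X \<in> conj_class N"
  then obtain P Q P' Q' where 1: "P ** Q = mat 1" "Q ** P = mat 1" "N = Q ** M ** P"
    "P' ** Q' = mat 1" "Q' ** P' = mat 1" "X = Q' ** N ** P'"
    using assms by (auto simp: conj_class_eq)
  then have "X = (Q' ** Q) ** M ** (P ** P')"
    by (simp add: matrix_mul_assoc)
  moreover have "(P ** P') ** (Q' ** Q) = mat 1" "(Q' ** Q) ** (P ** P') = mat 1"
    using 1 by (metis matrix_mul_assoc matrix_mul_rid)+
  ultimately show "X \<in> conj_class M"
    unfolding conj_class_eq by blast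
qed

lemma conj_class_sym:
  assumes "N \<in> conj_class M"
  shows "M \<in> conj_class N"
proof -
  obtain P Q where 1: "P ** Q = mat 1" "Q ** P = mat 1" "N = Q ** M ** P"
    using assms by (auto simp: conj_class_eq)
  have "P ** N ** Q = (P ** Q) ** M ** (P ** Q)"
    unfolding 1(3) by (simp only: matrix_mul_assoc)
  then have "M = P ** N ** Q"
    unfolding 1(1) by simp
  then show ?thesis
    using 1 unfolding conj_class_eq by blast
qed

lemma conj_class_cong: "N \<in> conj_class M \<Longrightarrow> conj_class N = conj_class M"
  using conj_class_sub conj_class_sym by blast

abbreviation mat2 :: "int \<Rightarrow> int \<Rightarrow> int \<Rightarrow> int \<Rightarrow> int^2^2" where
  "mat2 p q r s \<equiv> vector [vector [p, q], vector [r, s]]"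

lemma mat2_entries: "M = mat2 (M $ 1 $ 1) (M $ 1 $ 2) (M $ 2 $ 1) (M $ 2 $ 2)"
  by (simp add: vec_eq_iff forall_2)

lemma mat2_mult: "mat2 p q r s ** mat2 p' q' r' s' =
    mat2 (p * p' + q * r') (p * q' + q * s') (r * p' + s * r') (r * q' + s * s')"
  by (simp add: vec_eq_iff forall_2 matrix_matrix_mult_def sum_2)

lemma mat2_eq_iff: "mat2 p q r s = mat2 p' q' r' s' \<longleftrightarrow> p = p' \<and> q = q' \<and> r = r' \<and> s = s'"
  by (auto simp: vec_eq_iff forall_2)

lemma mat2_one: "mat 1 = mat2 1 0 0 1"
  by (simp add: vec_eq_iff forall_2 mat_def)

lemma mat2_zero: "0 = mat2 0 0 0 0"
  by (simp add: vec_eq_iff forall_2)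

lemma nilpotent_mat_conj_class:
  assumes "nilpotent_mat M" "N \<in> conj_class M"
  shows "nilpotent_mat N"
proof -
  obtain P Q where PQ: "P ** Q = mat 1" "Q ** P = mat 1" "N = Q ** M ** P"
    using assms(2) by (auto simp: conj_class_eq)
  have pow: "((**) N ^^ k) (mat 1) = Q ** ((**) M ^^ k) (mat 1) ** P" for k
  proof (induction k)
    case 0
    then show ?case
      by (simp add: PQ)
  next
    case (Suc k)
    let ?X = "((**) M ^^ k) (mat 1)"
    have "((**) N ^^ Suc k) (mat 1) = N ** (Q ** ?X ** P)"
      by (simp add: Suc)
    also have "\<dots> = Q ** M ** (P ** Q) ** ?X ** P"
      by (simp only: PQ(3) matrix_mul_assoc)
    also have "\<dots> = Q ** ((**) M ^^ Suc k) (mat 1) ** P"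
      by (simp only: PQ(1) matrix_mul_rid funpow.simps o_apply matrix_mul_assoc)
    finally show ?case .
  qed
  obtain k where k: "((**) M ^^ k) (mat 1) = 0"
    using assms(1) by (auto simp: nilpotent_mat_def)
  have "((**) N ^^ k) (mat 1) = 0"
    by (simp add: pow k matrix_matrix_mult_def vec_eq_iff)
  then show ?thesis
    by (auto simp: nilpotent_mat_def)
qed

text \<open>The witness is the last nonzero power of \<open>M\<close>; its columns supply kernel vectors.\<close>

lemma nilpotent_mat_annihilates:
  assumes "nilpotent_mat (M :: int^'n^'n)"
  shows "\<exists>Q :: int^'n^'n. Q \<noteq> 0 \<and> M ** Q = 0"
proof -
  let ?P = "\<lambda>k. ((**) M ^^ k) (mat 1) = 0"
  define k where "k = (LEAST k. ?P k)"
  have k: "?P k"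
    using assms unfolding nilpotent_mat_def k_def by (rule LeastI_ex)
  have "mat 1 \<noteq> (0 :: int^'n^'n)"
    by (auto simp: mat_def vec_eq_iff)
  with k obtain j where j: "k = Suc j"
    by (cases k) auto
  then have "\<not> ?P j"
    using not_less_Least[of j ?P] by (simp add: k_def)
  moreover have "M ** ((**) M ^^ j) (mat 1) = 0"
    using k j by simp
  ultimately show ?thesis
    by (intro exI conjI)
qed

text \<open>A primitive vector in the kernel, completed to a basis of \<open>\<int>\<^sup>2\<close>, makes the first column zero;
  the remaining diagonal entry is then nilpotent, hence zero.\<close>

lemma nilpotent_mat2_conj_upper:
  assumes "nilpotent_mat (M :: int^2^2)"
  shows "\<exists>m. mat2 0 m 0 0 \<in> conj_class M"
proof -
  obtain Q :: "int^2^2" where "Q \<noteq> 0" and Q: "M ** Q = 0"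
    using nilpotent_mat_annihilates[OF assms] by blast
  then obtain i j where "Q $ i $ j \<noteq> 0"
    by (auto simp: vec_eq_iff)
  then have nz: "Q $ 1 $ j \<noteq> 0 \<or> Q $ 2 $ j \<noteq> 0"
    using exhaust_2[of i] by auto
  define g where "g = gcd (Q $ 1 $ j) (Q $ 2 $ j)"
  have "g \<noteq> 0"
    using nz by (simp add: g_def)
  obtain v1 v2 where v: "Q $ 1 $ j = v1 * g" "Q $ 2 $ j = v2 * g" "coprime v1 v2"
    using gcd_coprime_exists[of "Q $ 1 $ j" "Q $ 2 $ j"] \<open>g \<noteq> 0\<close> unfolding g_def by blast
  obtain s t where st: "s * v1 + t * v2 = 1"
    using bezout_int[of v1 v2] v(3) by auto
  have ker: "M $ i $ 1 * v1 + M $ i $ 2 * v2 = 0" for i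
  proof -
    have "(M ** Q) $ i $ j = 0"
      by (simp add: Q)
    then have "(M $ i $ 1 * v1 + M $ i $ 2 * v2) * g = 0"
      by (simp add: matrix_matrix_mult_def sum_2 v algebra_simps)
    then show ?thesis
      using \<open>g \<noteq> 0\<close> by simp
  qed
  let ?P = "mat2 v1 (- t) v2 s" and ?R = "mat2 s t (- v2) v1"
  have PR: "?P ** ?R = mat 1" "?R ** ?P = mat 1"
    using st by (auto simp: mat2_mult mat2_one mat2_eq_iff algebra_simps)
  let ?N = "?R ** M ** ?P"
  have N: "?N \<in> conj_class M"
    using PR unfolding conj_class_eq by blast
  have "M ** ?P = mat2 0 (- M $ 1 $ 1 * t + M $ 1 $ 2 * s) 0 (- M $ 2 $ 1 * t + M $ 2 $ 2 * s)"
    using ker[of 1] ker[of 2] by (subst mat2_entries[of M]) (simp add: mat2_mult mat2_eq_iff)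
  then obtain m n where mn: "?N = mat2 0 m 0 n"
    by (simp add: mat2_mult mat2_eq_iff flip: matrix_mul_assoc)
  \<comment> \<open>The diagonal of an upper triangular matrix is multiplicative, so nilpotency forces \<open>n = 0\<close>.\<close>
  have pow: "((**) (mat2 0 m 0 n) ^^ k) (mat 1) $ 2 $ 2 = n ^ k" for k
    by (induction k) (simp_all add: mat2_one matrix_matrix_mult_def sum_2)
  have "nilpotent_mat (mat2 0 m 0 n)"
    using nilpotent_mat_conj_class[OF assms N] mn by simp
  then obtain k where "((**) (mat2 0 m 0 n) ^^ k) (mat 1) = 0"
    by (auto simp: nilpotent_mat_def)
  then have "n ^ k = 0"
    using pow[of k] by simp
  then show ?thesis
    using N mn by auto
qed

text \<open>Every entry of \<open>Q ** M ** P\<close> is an integer combination of the entries of \<open>M\<close>, so a common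
  divisor of the latter divides the former. Applied in both directions this makes the normal form
  unique up to sign.\<close>

lemma mat2_upper_conj_dvd:
  assumes "mat2 0 n 0 0 \<in> conj_class (mat2 0 m 0 0)"
  shows "m dvd n"
proof -
  obtain P Q where "mat2 0 n 0 0 = Q ** mat2 0 m 0 0 ** P"
    using assms by (auto simp: conj_class_eq)
  then have "n = Q $ 1 $ 1 * m * P $ 2 $ 2"
    by (subst (asm) mat2_entries[of P], subst (asm) mat2_entries[of Q])
      (simp add: mat2_mult mat2_eq_iff)
  then show ?thesis
    by simp
qed

lemma nilpotent_mat2_normal_form:
  fixes M :: "int^2^2"
  assumes "nilpotent_mat M" "M \<noteq> 0"
  shows "\<exists>!N. N \<in> conj_class M \<and> (\<exists>m::nat. 1 \<le> m \<and> N = mat2 0 (int m) 0 0)"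
proof -
  obtain m where m: "mat2 0 m 0 0 \<in> conj_class M"
    using nilpotent_mat2_conj_upper[OF assms(1)] by blast
  have "m \<noteq> 0"
  proof
    assume "m = 0"
    then have "M \<in> conj_class 0"
      using conj_class_sym[OF m] by (simp flip: mat2_zero)
    then show False
      using assms(2) by (auto simp: conj_class_eq matrix_matrix_mult_def vec_eq_iff)
  qed
  \<comment> \<open>Changing the sign of the second basis vector makes the entry positive.\<close>
  have "mat2 0 (- m) 0 0 = mat2 1 0 0 (- 1) ** mat2 0 m 0 0 ** mat2 1 0 0 (- 1)"
    by (simp add: mat2_mult mat2_eq_iff)
  moreover have "mat2 1 0 0 (- 1) ** mat2 1 0 0 (- 1) = mat 1"
    by (simp add: mat2_mult mat2_one mat2_eq_iff)
  ultimately have "mat2 0 (- m) 0 0 \<in> conj_class (mat2 0 m 0 0)"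
    unfolding conj_class_eq by blast
  then have "mat2 0 (- m) 0 0 \<in> conj_class M"
    using conj_class_cong[OF m] by simp
  with m have abs: "mat2 0 \<bar>m\<bar> 0 0 \<in> conj_class M"
    by (cases "m < 0") auto
  show ?thesis
  proof (rule ex1I[of _ "mat2 0 \<bar>m\<bar> 0 0"], intro conjI exI[of _ "nat \<bar>m\<bar>"])
    show "mat2 0 \<bar>m\<bar> 0 0 \<in> conj_class M" "1 \<le> nat \<bar>m\<bar>"
      "mat2 0 \<bar>m\<bar> 0 0 = mat2 0 (int (nat \<bar>m\<bar>)) 0 0"
      using abs \<open>m \<noteq> 0\<close> by simp_all
  next
    fix N
    assume "N \<in> conj_class M \<and> (\<exists>n::nat. 1 \<le> n \<and> N = mat2 0 (int n) 0 0)"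
    then obtain n :: nat where N: "N = mat2 0 (int n) 0 0" "N \<in> conj_class M"
      by blast
    have "mat2 0 (int n) 0 0 \<in> conj_class (mat2 0 \<bar>m\<bar> 0 0)"
      "mat2 0 \<bar>m\<bar> 0 0 \<in> conj_class (mat2 0 (int n) 0 0)"
      using N abs conj_class_cong by blast+
    then have "\<bar>m\<bar> dvd int n" "int n dvd \<bar>m\<bar>"
      using mat2_upper_conj_dvd by blast+
    then show "N = mat2 0 \<bar>m\<bar> 0 0"
      using N by (simp add: mat2_eq_iff zdvd_antisym_nonneg)
  qed
qed


section \<open>Lattices of rational numbers\<close>

text \<open>Division with remainder by the least positive element of the subgroup.\<close>

lemma int_subgroup_cyclic:
  fixes G :: "int set"
  assumes "0 \<in> G" and diff: "\<And>x y. x \<in> G \<Longrightarrow> y \<in> G \<Longrightarrow> x - y \<in> G"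
  shows "\<exists>g\<ge>0. G = range (\<lambda>n. n * g)"
proof (cases "G = {0}")
  case True
  then show ?thesis
    by (intro exI[of _ 0]) auto
next
  case False
  then obtain x where x: "x \<in> G" "x \<noteq> 0"
    using assms(1) by blast
  have neg: "- y \<in> G" if "y \<in> G" for y
    using diff[OF assms(1) that] by simp
  have add: "y + z \<in> G" if "y \<in> G" "z \<in> G" for y z
    using diff[OF that(1) neg[OF that(2)]] by simp
  define g where "g = (LEAST n::nat. 0 < n \<and> int n \<in> G)"
  have "0 < nat \<bar>x\<bar> \<and> int (nat \<bar>x\<bar>) \<in> G"
    using x neg by (auto simp: abs_if)
  then have g: "0 < g \<and> int g \<in> G"
    unfolding g_def by (rule LeastI)
  have min: "g \<le> n" if "0 < n" "int n \<in> G" for n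
    unfolding g_def using that by (auto intro: Least_le)
  have mult_nat: "int n * int g \<in> G" for n
    by (induction n) (use assms(1) g add in \<open>auto simp: algebra_simps\<close>)
  have mult: "n * int g \<in> G" for n
  proof (cases "0 \<le> n")
    case True
    then show ?thesis
      using mult_nat[of "nat n"] by simp
  next
    case False
    then show ?thesis
      using neg[OF mult_nat[of "nat (- n)"]] by simp
  qed
  have "y \<in> range (\<lambda>n. n * int g)" if "y \<in> G" for y
  proof -
    have "y - (y div int g) * int g \<in> G"
      using diff that mult by blast
    then have "y mod int g \<in> G"
      by (simp add: minus_div_mult_eq_mod)
    then have "y mod int g = 0"
      using min[of "nat (y mod int g)"] g
        pos_mod_sign[of "int g" y] pos_mod_bound[of "int g" y] by fastforce
    then show ?thesis
      by (auto simp: mod_eq_0_iff_dvd elim!: dvdE)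
  qed
  then show ?thesis
    using mult by (intro exI[of _ "int g"]) auto
qed

text \<open>A bound on the denominators reduces subgroups of \<open>\<rat>\<close> to subgroups of \<open>\<int>\<close>.\<close>

lemma rat_subgroup_cyclic:
  fixes H :: "rat set"
  assumes "0 \<in> H" and diff: "\<And>x y. x \<in> H \<Longrightarrow> y \<in> H \<Longrightarrow> x - y \<in> H"
    and "0 < N" and denom: "\<And>x. x \<in> H \<Longrightarrow> of_int N * x \<in> \<int>"
  shows "\<exists>g\<ge>0. H = int_span {g}"
proof -
  let ?N = "of_int N :: rat"
  have N: "?N > 0"
    using assms(3) by simp
  define G where "G = {n. of_int n / ?N \<in> H}"
  have "\<exists>g\<ge>0. G = range (\<lambda>n. n * g)"
    by (rule int_subgroup_cyclic) (use assms(1) diff in \<open>auto simp: G_def diff_divide_distrib\<close>)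
  then obtain g where g: "0 \<le> g" "G = range (\<lambda>n. n * g)"
    by blast
  have "x \<in> H \<longleftrightarrow> (\<exists>n. x = of_int n * (of_int g / ?N))" for x
  proof
    assume "x \<in> H"
    then obtain n where n: "?N * x = of_int n"
      using denom by (auto elim: Ints_cases)
    then have x: "x = of_int n / ?N"
      using N by (simp add: field_simps)
    then have "n \<in> G"
      using \<open>x \<in> H\<close> by (simp add: G_def)
    then show "\<exists>n. x = of_int n * (of_int g / ?N)"
      using g x by auto
  next
    assume "\<exists>n. x = of_int n * (of_int g / ?N)"
    then obtain n where "x = of_int (n * g) / ?N"
      by auto
    moreover have "n * g \<in> G"
      using g(2) by blast
    ultimately show "x \<in> H"
      unfolding G_def by simp
  qed
  then have "H = int_span {of_int g / ?N}"
    by (auto simp: int_mod.span_singleton)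
  moreover have "0 \<le> of_int g / ?N"
    using g N by simp
  ultimately show ?thesis
    by blast
qed

lemma rat_common_denominator:
  assumes "finite (B :: rat set)"
  shows "\<exists>N>0. \<forall>x\<in>B. of_int N * x \<in> \<int>"
  using assms
proof induction
  case empty
  then show ?case
    by (intro exI[of _ 1]) auto
next
  case (insert x B)
  then obtain N where N: "N > 0" "\<forall>x\<in>B. of_int N * x \<in> \<int>"
    by blast
  obtain p q where q: "quotient_of x = (p, q)"
    by fastforce
  then have "q > 0" "x = of_int p / of_int q"
    by (simp_all add: quotient_of_denom_pos quotient_of_div)
  then have *: "of_int q * x = of_int p"
    by simp
  have "of_int (q * N) * y \<in> \<int>" if "y \<in> insert x B" for y
  proof (cases "y = x")
    case True
    have "of_int (q * N) * x = of_int (N * p)"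
      using * by (simp add: mult.commute mult.left_commute)
    then show ?thesis
      using True by (simp only: Ints_of_int)
  next
    case False
    then have "of_int N * y \<in> \<int>"
      using N that by blast
    then have "of_int q * (of_int N * y) \<in> \<int>"
      by (rule Ints_mult[OF Ints_of_int])
    then show ?thesis
      by (simp only: of_int_mult mult.assoc)
  qed
  moreover have "0 < q * N"
    using N \<open>q > 0\<close> by simp
  ultimately show ?case
    by blast
qed

lemma rat_fin_gen_cyclic:
  assumes "fin_gen_int (L :: rat set)"
  shows "\<exists>g\<ge>0. L = int_span {g}"
proof -
  obtain B where B: "finite B" "L = int_span B"
    using assms by (auto simp: fin_gen_int_def)
  obtain N where N: "N > 0" "\<forall>x\<in>B. of_int N * x \<in> \<int>"
    using rat_common_denominator[OF B(1)] by blast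
  have "of_int N * x \<in> \<int>" if "x \<in> L" for x
    using that unfolding B(2)
  proof (induction rule: int_mod.span_induct_alt)
    case base
    then show ?case
      by simp
  next
    case (step c x y)
    then have "of_int N * x \<in> \<int>"
      using N by blast
    then have "of_int c * (of_int N * x) + of_int N * y \<in> \<int>"
      by (rule Ints_add[OF Ints_mult[OF Ints_of_int] step(2)])
    then show ?case
      by (simp only: distrib_left mult.left_commute)
  qed
  then show ?thesis
    using N B by (intro rat_subgroup_cyclic[of L N]) (auto intro: int_mod.span_zero int_mod.span_diff)
qed

lemma int_span_rat_eq_iff:
  fixes g h :: rat
  assumes "0 < g" "0 < h"
  shows "int_span {g} = int_span {h} \<longleftrightarrow> g = h"
proof
  assume *: "int_span {g} = int_span {h}"
  have "g \<in> int_span {h}" "h \<in> int_span {g}"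
    using int_mod.span_base[of g "{g}"] int_mod.span_base[of h "{h}"] * by auto
  then obtain m n :: int where mn: "g = of_int m * h" "h = of_int n * g"
    unfolding int_mod.span_singleton by blast
  have "of_int (m * n) * g = of_int m * (of_int n * g)"
    by simp
  also have "\<dots> = 1 * g"
    using mn by simp
  finally have "of_int (m * n) * g = 1 * g" .
  then have "of_int (m * n) = (1::rat)"
    using assms by (simp only: mult_cancel_right) auto
  then have "m * n = 1"
    by (simp only: of_int_eq_1_iff)
  moreover have "m > 0"
    using mn(1) assms by (simp add: zero_less_mult_iff)
  ultimately have "m = 1"
    by (simp add: zmult_eq_1_iff)
  then show "g = h"
    using mn by simp
qed simp

lemma gcd_rat_unique:
  assumes "0 < d" "int_span {p, q} = int_span {d}"
  shows "gcd_rat p q = d"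
  unfolding gcd_rat_def using assms by (intro the_equality) (auto simp: int_span_rat_eq_iff)

lemma
  assumes "0 < p" "0 < q"
  shows gcd_rat_pos: "0 < gcd_rat p q"
    and int_span_gcd_rat: "int_span {gcd_rat p q} = int_span {p, q}"
proof -
  have "fin_gen_int (int_span {p, q})"
    unfolding fin_gen_int_def by (rule exI[of _ "{p, q}"]) simp
  then obtain g where g: "0 \<le> g" "int_span {p, q} = int_span {g}"
    using rat_fin_gen_cyclic by blast
  have "g \<noteq> 0"
  proof
    assume "g = 0"
    then have "p = 0"
      using g int_mod.span_base[of p "{p, q}"] by (auto simp: int_mod.span_singleton)
    then show False
      using assms by simp
  qed
  then have "0 < g"
    using g by simp
  moreover from this have "gcd_rat p q = g"
    using g(2) by (rule gcd_rat_unique)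
  ultimately show "0 < gcd_rat p q" "int_span {gcd_rat p q} = int_span {p, q}"
    by (simp_all only: g(2))
qed

lemma comm_semigroup_gcd_rat: "comm_semigroup_on {q. 0 < q} gcd_rat"
proof -
  have commute: "gcd_rat x y = gcd_rat y x" for x y
    by (simp add: gcd_rat_def insert_commute)
  have "gcd_rat (gcd_rat x y) z = gcd_rat x (gcd_rat y z)" if "0 < x" "0 < y" "0 < z" for x y z
  proof (rule gcd_rat_unique)
    have "int_span {gcd_rat x y, z} = int_span (insert z {gcd_rat x y})"
      by (simp add: insert_commute)
    also have "\<dots> = int_span (insert z {x, y})"
      by (rule int_mod.span_insert_cong) (simp add: int_span_gcd_rat that)
    also have "\<dots> = int_span (insert x {y, z})"
      by (simp add: insert_commute)
    also have "\<dots> = int_span (insert x {gcd_rat y z})"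
      by (rule int_mod.span_insert_cong) (simp add: int_span_gcd_rat that)
    also have "\<dots> = int_span {gcd_rat x (gcd_rat y z)}"
      by (simp add: int_span_gcd_rat gcd_rat_pos that)
    finally show "int_span {gcd_rat x y, z} = int_span {gcd_rat x (gcd_rat y z)}" .
  qed (simp add: gcd_rat_pos that)
  then show ?thesis
    using commute by (auto simp: comm_semigroup_on_def gcd_rat_pos)
qed

text \<open>The divisibility order of this semigroup is inclusion of the lattices \<open>\<int>q\<close>, which is
  antisymmetric.\<close>

lemma gcd_rat_antisym:
  assumes pos: "0 < p" "0 < q" "0 < u" "0 < v" and "gcd_rat p u = q" "gcd_rat q v = p"
  shows "p = q"
proof -
  have "int_span {p} \<subseteq> int_span {p, u}" "int_span {q} \<subseteq> int_span {q, v}"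
    by (auto intro!: int_mod.span_mono)
  then have "int_span {p} = int_span {q}"
    using int_span_gcd_rat[of p u] int_span_gcd_rat[of q v] assms by auto
  then show ?thesis
    using pos by (simp add: int_span_rat_eq_iff)
qed

lemma rat_lattices_iso: "semigroup_isomorphic {q. 0 < q} gcd_rat rat_lattices lattice_add"
proof (rule semigroup_isomorphicI, rule semigroup_isoI[OF comm_semigroup_gcd_rat])
  let ?h = "\<lambda>q::rat. int_span {q}"
  have nz: "int_span {q} \<noteq> {0}" if "0 < q" for q :: rat
    using int_mod.span_base[of q "{q}"] that by auto
  have "rat_lattices = ?h ` {q. 0 < q}"
  proof
    show "?h ` {q. 0 < q} \<subseteq> rat_lattices"
      using nz by (auto simp: rat_lattices_def fin_gen_int_def)
    show "rat_lattices \<subseteq> ?h ` {q. 0 < q}"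
    proof
      fix L :: "rat set"
      assume L: "L \<in> rat_lattices"
      then obtain g where g: "g \<ge> 0" "L = int_span {g}"
        using rat_fin_gen_cyclic by (auto simp: rat_lattices_def)
      moreover have "g \<noteq> 0"
        using L g(2) by (auto simp: rat_lattices_def int_mod.span_singleton)
      ultimately show "L \<in> ?h ` {q. 0 < q}"
        by auto
    qed
  qed
  then show "bij_betw ?h {q. 0 < q} rat_lattices"
    by (auto simp: bij_betw_def inj_on_def int_span_rat_eq_iff)
  show "lattice_add (int_span {x}) (int_span {y}) = int_span {gcd_rat x y}"
    if "x \<in> {q. 0 < q}" "y \<in> {q. 0 < q}" for x y
    using that int_mod.span_Un[of "{x}" "{y}"]
    by (simp add: lattice_add_def int_span_gcd_rat insert_commute)
qed

text \<open>For \<open>k\<close> dividing \<open>lcm m n\<close>, the fraction \<open>1 / k\<close> is a multiple of \<open>1 / lcm m n\<close>; conversely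
  a Bezout relation \<open>x n + y m = gcd m n\<close> divided by \<open>m n\<close> writes \<open>1 / lcm m n\<close> as a combination
  of \<open>1 / m\<close> and \<open>1 / n\<close>.\<close>

lemma gcd_rat_unit_fractions:
  fixes m n :: nat
  assumes "1 \<le> m" "1 \<le> n"
  shows "gcd_rat (1 / of_nat m) (1 / of_nat n) = 1 / of_nat (lcm m n)"
proof (rule gcd_rat_unique)
  let ?l = "1 / of_nat (lcm m n) :: rat"
  have l: "(of_nat (lcm m n) :: rat) \<noteq> 0"
    using assms by simp
  show "0 < ?l"
    using assms by (simp add: lcm_pos_nat)
  have ml: "1 / of_nat k \<in> int_span {?l}" if "k dvd lcm m n" for k
  proof -
    obtain c where c: "lcm m n = k * c"
      using \<open>k dvd lcm m n\<close> by (rule dvdE)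
    then have "1 / of_nat k = of_int (int c) * ?l"
      using l by (simp add: field_simps)
    then show ?thesis
      unfolding int_mod.span_singleton by blast
  qed
  obtain x y :: int where "x * int n + y * int m = gcd (int n) (int m)"
    using bezout_int by blast
  then have xy: "x * int n + y * int m = int (gcd m n)"
    by (simp add: gcd.commute)
  have "int (gcd m n) * int (lcm m n) = int m * int n"
    by (simp flip: of_nat_mult)
  then have "(x * int n + y * int m) * int (lcm m n) = int m * int n"
    by (simp add: xy)
  then have "(of_int ((x * int n + y * int m) * int (lcm m n)) :: rat) = of_int (int m * int n)"
    by (simp only:)
  then have "?l = of_int x * (1 / of_nat m) + of_int y * (1 / of_nat n)"
    using assms l by (simp add: field_simps)
  then have "?l \<in> int_span {1 / of_nat m, 1 / of_nat n}"
    unfolding int_mod.span_pair by blast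
  then show "int_span {1 / of_nat m, 1 / of_nat n} = int_span {?l}"
    using ml[of m] ml[of n] by (simp add: int_mod.span_eq)
qed

lemma comm_semigroup_unit_fractions:
  "comm_semigroup_on {1 / of_nat m | m::nat. 1 \<le> m} gcd_rat"
proof (rule comm_semigroup_on_subset[OF comm_semigroup_gcd_rat])
  show "gcd_rat x y \<in> {1 / of_nat m | m::nat. 1 \<le> m}"
    if xy: "x \<in> {1 / of_nat m | m::nat. 1 \<le> m}" "y \<in> {1 / of_nat m | m::nat. 1 \<le> m}" for x y
  proof -
    obtain m n :: nat where mn: "x = 1 / of_nat m" "y = 1 / of_nat n" "1 \<le> m" "1 \<le> n"
      using xy by blast
    then have "gcd_rat x y = 1 / of_nat (lcm m n)" "1 \<le> lcm m n"
      using lcm_pos_nat[of m n] by (simp_all add: gcd_rat_unit_fractions)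
    then show ?thesis
      by blast
  qed
qed auto

lemma unit_fractions_lcm_iso:
  "\<exists>h. semigroup_iso h {1 / of_nat m | m::nat. 1 \<le> m} gcd_rat {m::nat. 1 \<le> m} lcm \<and>
    (\<forall>m\<ge>1. h (1 / of_nat m) = m)"
proof (intro exI conjI)
  \<comment> \<open>The reciprocal; the rounding is exact on unit fractions and only adjusts the type.\<close>
  let ?h = "\<lambda>q::rat. nat \<lfloor>1 / q\<rfloor>"
  show h: "\<forall>m\<ge>1. ?h (1 / of_nat m) = m"
    by simp
  show "semigroup_iso ?h {1 / of_nat m | m::nat. 1 \<le> m} gcd_rat {m::nat. 1 \<le> m} lcm"
  proof (rule semigroup_isoI[OF comm_semigroup_unit_fractions])
    show "bij_betw ?h {1 / of_nat m | m::nat. 1 \<le> m} {m::nat. 1 \<le> m}"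
      by (rule bij_betwI[of _ _ _ "\<lambda>m. 1 / of_nat m"]) auto
    show "lcm (?h x) (?h y) = ?h (gcd_rat x y)"
      if xy: "x \<in> {1 / of_nat m | m::nat. 1 \<le> m}" "y \<in> {1 / of_nat m | m::nat. 1 \<le> m}" for x y
    proof -
      obtain m n :: nat where "x = 1 / of_nat m" "y = 1 / of_nat n" "1 \<le> m" "1 \<le> n"
        using xy by blast
      then show ?thesis
        by (simp add: gcd_rat_unit_fractions)
    qed
  qed
qed


section \<open>Products, multiplier rings and \<open>\<epsilon>\<close>-equivalence of lattices\<close>

lemma lattice_multI:
  fixes n :: nat
  assumes "\<And>i. i < n \<Longrightarrow> x i \<in> L" "\<And>i. i < n \<Longrightarrow> y i \<in> M"
  shows "(\<Sum>i<n. x i * y i) \<in> lattice_mult L M"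
  unfolding lattice_mult_def mem_Collect_eq
  by (rule exI[of _ n], rule exI[of _ x], rule exI[of _ y]) (simp add: assms)

lemma lattice_mult_subset:
  assumes "0 \<in> N" "\<And>x y. x \<in> N \<Longrightarrow> y \<in> N \<Longrightarrow> x + y \<in> N"
    and "\<And>x y. x \<in> L \<Longrightarrow> y \<in> M \<Longrightarrow> x * y \<in> N"
  shows "lattice_mult L M \<subseteq> N"
proof
  fix z
  assume "z \<in> lattice_mult L M"
  then obtain n :: nat and x y where z: "z = (\<Sum>i<n. x i * y i)" "\<forall>i<n. x i \<in> L \<and> y i \<in> M"
    unfolding lattice_mult_def by blast
  have "(\<Sum>i<k. x i * y i) \<in> N" if "k \<le> n" for k
    using that
  proof (induction k)
    case 0
    then show ?case
      using assms(1) by simp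
  next
    case (Suc k)
    then show ?case
      using assms(2,3) z(2) by simp
  qed
  then show "z \<in> N"
    using z(1) by simp
qed

text \<open>Two summands already give every element of a product of two orders of rank two.\<close>

lemma lattice_mult_two_products:
  assumes "x1 \<in> L" "y1 \<in> M" "x2 \<in> L" "y2 \<in> M"
  shows "x1 * y1 + x2 * y2 \<in> lattice_mult L M"
  using lattice_multI[of 2 "\<lambda>i. if i = 0 then x1 else x2" L "\<lambda>i. if i = 0 then y1 else y2" M] assms
  by (simp add: numeral_2_eq_2)

lemma lattice_mult_product: "x \<in> L \<Longrightarrow> y \<in> M \<Longrightarrow> x * y \<in> lattice_mult L M"
  using lattice_multI[of 1 "\<lambda>_. x" L "\<lambda>_. y" M] by simp

lemma lattice_mult_scaled:
  "lattice_mult ((*) u ` L) ((*) v ` M) = (*) (u * v) ` lattice_mult L M"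
proof
  show "lattice_mult ((*) u ` L) ((*) v ` M) \<subseteq> (*) (u * v) ` lattice_mult L M"
  proof
    fix z
    assume "z \<in> lattice_mult ((*) u ` L) ((*) v ` M)"
    then obtain n :: nat and x y where z: "z = (\<Sum>i<n. x i * y i)"
      "\<forall>i<n. x i \<in> (*) u ` L \<and> y i \<in> (*) v ` M"
      unfolding lattice_mult_def by blast
    then have "\<forall>i<n. \<exists>x'. x' \<in> L \<and> x i = u * x'" "\<forall>i<n. \<exists>y'. y' \<in> M \<and> y i = v * y'"
      by blast+
    then obtain x' y' where "\<forall>i<n. x' i \<in> L \<and> x i = u * x' i" "\<forall>i<n. y' i \<in> M \<and> y i = v * y' i"
      unfolding choice_iff' by blast
    then have *: "\<And>i. i < n \<Longrightarrow> x' i \<in> L" "\<And>i. i < n \<Longrightarrow> y' i \<in> M"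
      "\<And>i. i < n \<Longrightarrow> x i * y i = u * v * (x' i * y' i)"
      by (auto simp: mult_ac)
    then have "z = u * v * (\<Sum>i<n. x' i * y' i)"
      using z(1) by (simp add: sum_distrib_left)
    moreover have "(\<Sum>i<n. x' i * y' i) \<in> lattice_mult L M"
      using * by (intro lattice_multI)
    ultimately show "z \<in> (*) (u * v) ` lattice_mult L M"
      by blast
  qed
  show "(*) (u * v) ` lattice_mult L M \<subseteq> lattice_mult ((*) u ` L) ((*) v ` M)"
  proof
    fix z
    assume "z \<in> (*) (u * v) ` lattice_mult L M"
    then obtain n :: nat and x y where z: "z = u * v * (\<Sum>i<n. x i * y i)"
      "\<forall>i<n. x i \<in> L \<and> y i \<in> M"
      unfolding lattice_mult_def by blast
    then have "z = (\<Sum>i<n. (u * x i) * (v * y i))"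
      by (simp add: sum_distrib_left mult_ac)
    then show "z \<in> lattice_mult ((*) u ` L) ((*) v ` M)"
      using lattice_multI[of n "\<lambda>i. u * x i" "(*) u ` L" "\<lambda>i. v * y i" "(*) v ` M"] z(2) by simp
  qed
qed

lemma image_mult_int_span_pair: "(*) u ` int_span {x, y} = int_span {u * x, u * y}"
proof (rule set_eqI)
  fix z
  have "z \<in> (*) u ` int_span {x, y} \<longleftrightarrow> (\<exists>m n. z = u * (of_int m * x + of_int n * y))"
    unfolding int_mod.span_pair by blast
  also have "\<dots> \<longleftrightarrow> z \<in> int_span {u * x, u * y}"
    by (simp add: int_mod.span_pair distrib_left mult.left_commute)
  finally show "z \<in> (*) u ` int_span {x, y} \<longleftrightarrow> z \<in> int_span {u * x, u * y}" .
qed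

lemma order_of_unit_mult:
  assumes "u dvd 1"
  shows "order_of ((*) u ` L) = order_of L"
proof -
  obtain v where v: "u * v = 1"
    using assms by (metis dvdE)
  have "(*) x ` (*) u ` L \<subseteq> (*) u ` L \<longleftrightarrow> (*) x ` L \<subseteq> L" for x
  proof
    assume *: "(*) x ` (*) u ` L \<subseteq> (*) u ` L"
    show "(*) x ` L \<subseteq> L"
    proof (rule image_subsetI)
      fix y
      assume "y \<in> L"
      then obtain z where z: "z \<in> L" "x * (u * y) = u * z"
        using * by blast
      then have "(u * v) * (x * y) = (u * v) * z"
        by (metis mult.assoc mult.commute)
      then show "x * y \<in> L"
        using z v by simp
    qed
  next
    assume *: "(*) x ` L \<subseteq> L"
    show "(*) x ` (*) u ` L \<subseteq> (*) u ` L"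
    proof (rule image_subsetI)
      fix y
      assume "y \<in> (*) u ` L"
      then obtain z where z: "z \<in> L" "y = u * z"
        by blast
      then have "x * y = u * (x * z)" "x * z \<in> L"
        using * by (auto simp: mult.left_commute)
      then show "x * y \<in> (*) u ` L"
        by blast
    qed
  qed
  then show ?thesis
    by (simp add: order_of_def)
qed

text \<open>The inclusion in \<open>\<Lambda>\<close> comes from evaluating a multiplier at \<open>1\<close>, the other one from closure
  under multiplication.\<close>

lemma order_of_order:
  assumes "\<Lambda> \<in> orders smul"
  shows "order_of \<Lambda> = \<Lambda>"
proof
  show "\<Lambda> \<subseteq> order_of \<Lambda>"
    using assms lattice_mult_product[of _ \<Lambda> _ \<Lambda>] by (auto simp: orders_def order_of_def)
  show "order_of \<Lambda> \<subseteq> \<Lambda>"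
    using assms by (force simp: orders_def order_of_def)
qed

lemma unit_mult_cancel_image:
  assumes "u * v = (1::'a::comm_ring_1)"
  shows "(*) v ` (*) u ` L = L"
proof -
  have "v * (u * x) = x" for x
    using assms by (metis mult.assoc mult.commute mult_1)
  then show ?thesis
    by (simp add: image_image)
qed

lemma equiv_eps_rel: "equiv (full_lattices smul) (eps_rel smul)"
proof (rule equivI)
  show "eps_rel smul \<subseteq> full_lattices smul \<times> full_lattices smul"
    by (auto simp: eps_rel_def)
  show "refl_on (full_lattices smul) (eps_rel smul)"
    unfolding refl_on_def eps_rel_def by (auto intro!: exI[of _ 1])
  show "sym (eps_rel smul)"
  proof (rule symI)
    fix L M
    assume "(L, M) \<in> eps_rel smul"
    then obtain u where u: "L \<in> full_lattices smul" "M \<in> full_lattices smul" "u dvd 1" "M = (*) u ` L"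
      by (auto simp: eps_rel_def)
    then obtain v where v: "u * v = 1"
      by (metis dvdE)
    then have "L = (*) v ` M" "v dvd 1"
      using u unit_mult_cancel_image[OF v] by (auto intro: dvdI[of _ _ u] simp: mult.commute)
    then show "(M, L) \<in> eps_rel smul"
      using u unfolding eps_rel_def by blast
  qed
  show "trans (eps_rel smul)"
  proof (rule transI)
    fix L M N
    assume "(L, M) \<in> eps_rel smul" "(M, N) \<in> eps_rel smul"
    then obtain u v where u: "L \<in> full_lattices smul" "N \<in> full_lattices smul" "u dvd 1" "v dvd 1"
      "N = (*) v ` (*) u ` L"
      by (auto simp: eps_rel_def)
    then have "N = (*) (v * u) ` L" "v * u dvd 1"
      using mult_dvd_mono[of v 1 u 1] by (auto simp: image_comp o_def mult.assoc)
    then show "(L, N) \<in> eps_rel smul"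
      using u unfolding eps_rel_def by blast
  qed
qed

lemma eps_class_self: "L \<in> full_lattices smul \<Longrightarrow> L \<in> eps_class smul L"
  unfolding eps_class_def by (rule equiv_class_self[OF equiv_eps_rel])

lemma eps_class_eq:
  assumes "M \<in> eps_class smul L"
  shows "eps_class smul M = eps_class smul L"
  using assms equiv_class_eq[OF equiv_eps_rel, of L M] by (simp add: eps_class_def)

lemma mem_eps_class_iff:
  "M \<in> eps_class smul L \<longleftrightarrow> L \<in> full_lattices smul \<and> M \<in> full_lattices smul \<and>
    (\<exists>u. u dvd 1 \<and> M = (*) u ` L)"
  by (simp add: eps_class_def eps_rel_def)

lemma eps_class_in_eps_classes: "L \<in> full_lattices smul \<Longrightarrow> eps_class smul L \<in> eps_classes smul"
  by (simp add: eps_class_def eps_classes_def quotientI)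


text \<open>The multiplier ring is constant on an \<open>\<epsilon>\<close>-class and equals every order in it.\<close>

lemma order_in_eps_class:
  assumes "\<Lambda> \<in> orders smul" "\<Lambda> \<in> eps_class smul L"
  shows "\<Lambda> = order_of L"
  using assms order_of_order[OF assms(1)] order_of_unit_mult by (auto simp: mem_eps_class_iff)

lemma tuple_basis_unit_mult:
  fixes v :: "'a::comm_ring_1^'n::finite"
  assumes "u dvd 1" "tuple_basis int_scale v L"
  shows "tuple_basis int_scale (\<chi> j. u * v $ j) ((*) u ` L)"
proof -
  obtain w where w: "u * w = 1"
    using assms(1) by (metis dvdE)
  have "inj_on ((*) u) L"
    by (rule inj_on_inverseI[of _ "(*) w"])
      (metis w mult.assoc mult.commute mult_1)
  then have "bij_betw ((*) u) L ((*) u ` L)"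
    by (simp add: bij_betw_def)
  from bij_betw_trans[OF assms(2)[unfolded int_mod.tuple_basis_iff_bij_betw] this]
  show ?thesis
    by (simp add: int_mod.tuple_basis_iff_bij_betw o_def sum_distrib_left mult.left_commute)
qed

text \<open>If \<open>b = v P\<close> is another basis, then \<open>a b = (a v) P = v N P = b (Q N P)\<close>, where \<open>Q\<close> is the
  inverse of \<open>P\<close>.\<close>

lemma matrices_of_mult_conj_class:
  fixes v :: "'a::comm_ring_1^'n::finite"
  assumes v: "tuple_basis int_scale v L" and N: "(\<chi> j. a * v $ j) = tuple_mult int_scale v N"
  shows "{M. \<exists>b::'a^'n. tuple_basis int_scale b L \<and> (\<chi> j. a * b $ j) = tuple_mult int_scale b M} =
    conj_class N"
proof -
  have key: "(\<chi> j. a * b $ j) = tuple_mult int_scale b (Q ** N ** P)"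
    if PQ: "P ** Q = mat 1" and b: "b = tuple_mult int_scale v P" for P Q b
  proof -
    have "(\<chi> j. a * b $ j) = tuple_mult int_scale (\<chi> j. a * v $ j) P"
      by (simp add: b tuple_mult_def vec_eq_iff sum_distrib_left mult.left_commute)
    also have "\<dots> = tuple_mult int_scale v ((P ** Q) ** N ** P)"
      by (simp add: N PQ int_mod.tuple_mult_assoc)
    also have "\<dots> = tuple_mult int_scale b (Q ** N ** P)"
      unfolding b by (simp only: int_mod.tuple_mult_assoc matrix_mul_assoc)
    finally show ?thesis .
  qed
  show ?thesis
  proof (intro set_eqI iffI)
    fix M
    assume "M \<in> {M. \<exists>b::'a^'n. tuple_basis int_scale b L \<and>
      (\<chi> j. a * b $ j) = tuple_mult int_scale b M}"
    then obtain b :: "'a^'n" where b: "tuple_basis int_scale b L"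
      "(\<chi> j. a * b $ j) = tuple_mult int_scale b M"
      by blast
    obtain P Q where PQ: "P ** Q = mat 1" "Q ** P = mat 1" "b = tuple_mult int_scale v P"
      using b(1) int_mod.tuple_basis_change[OF v] by blast
    have "tuple_mult int_scale b M = tuple_mult int_scale b (Q ** N ** P)"
      using key[OF PQ(1,3)] b(2) by simp
    then have "M = Q ** N ** P"
      by (rule int_mod.tuple_mult_cancel[OF b(1)])
    then show "M \<in> conj_class N"
      using PQ unfolding conj_class_eq by blast
  next
    fix M
    assume "M \<in> conj_class N"
    then obtain P Q where PQ: "P ** Q = mat 1" "Q ** P = mat 1" "M = Q ** N ** P"
      by (auto simp: conj_class_eq)
    have "tuple_basis int_scale (tuple_mult int_scale v P) L"
      using PQ int_mod.tuple_basis_change[OF v] by blast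
    then show "M \<in> {M. \<exists>b::'a^'n. tuple_basis int_scale b L \<and>
      (\<chi> j. a * b $ j) = tuple_mult int_scale b M}"
      using key[OF PQ(1) refl] PQ(3) by blast
  qed
qed


section \<open>Lattices and orders in the dual numbers\<close>

locale dual_numbers = rat_algebra smul
  for smul :: "rat \<Rightarrow> 'a::comm_ring_1 \<Rightarrow> 'a" +
  fixes a :: 'a
  assumes basis: "tuple_basis smul (vector [1, a] :: 'a^2) UNIV"
    and a_square: "a\<^sup>2 = 0"
begin

definition num :: "rat \<Rightarrow> rat \<Rightarrow> 'a" where
  "num p q = smul p 1 + smul q a"

lemma num_surj: "\<exists>p q. x = num p q"
proof -
  have "x \<in> span {1, a}"
    using basis by (simp add: tuple_basis_2_iff)
  then show ?thesis
    by (auto simp: span_pair num_def)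
qed

lemma num_add: "num p q + num r s = num (p + r) (q + s)"
  by (simp add: num_def scale_left_distrib)

lemma num_diff: "num p q - num r s = num (p - r) (q - s)"
  by (simp add: num_def scale_left_diff_distrib)

lemma num_zero: "num 0 0 = 0"
  by (simp add: num_def)

lemma num_one: "num 1 0 = 1"
  by (simp add: num_def)

lemma num_a: "num 0 1 = a"
  by (simp add: num_def)

lemma num_smul_a: "num 0 q = smul q a"
  by (simp add: num_def)

lemma num_eq_iff: "num p q = num r s \<longleftrightarrow> p = r \<and> q = s"
proof
  assume "num p q = num r s"
  then have "smul (p - r) 1 + smul (q - s) a = 0"
    using num_diff[of p q r s] by (simp add: num_def)
  then have "p - r = 0 \<and> q - s = 0"
    using basis by (simp only: tuple_basis_2_iff vector_2)
  then show "p = r \<and> q = s"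
    by simp
qed simp

lemma smul_num: "smul c (num p q) = num (c * p) (c * q)"
  by (simp add: num_def scale_right_distrib)

lemma num_mult: "num p q * num r s = num (p * r) (p * s + q * r)"
proof -
  have *: "smul x y * smul w z = smul (x * w) (y * z)" for x y w z
    using smul_mult_left[of x y "smul w z"] smul_mult_left[of w z y] by (simp add: mult.commute)
  have "a * a = 0"
    using a_square by (simp add: power2_eq_square)
  then show ?thesis
    by (simp add: num_def distrib_left distrib_right * scale_left_distrib add.assoc)
qed

lemma of_int_num: "of_int n = num (of_int n) 0"
proof -
  have nat: "of_nat k = num (of_nat k) 0" for k
    by (induction k) (simp_all add: num_zero num_add flip: num_one)
  show ?thesis
  proof (cases n)
    case (nonneg k)
    then show ?thesis
      using nat[of k] by simp
  next
    case (neg k)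
    then have "of_int n = num 0 0 - of_nat (Suc k)"
      by (simp add: num_zero)
    also have "\<dots> = num (of_int n) 0"
      unfolding nat num_diff using neg by simp
    finally show ?thesis .
  qed
qed

lemma int_scale_num: "of_int n * num p q = num (of_int n * p) (of_int n * q)"
  by (simp add: of_int_num num_mult)

lemma num_unit_iff: "num p q dvd 1 \<longleftrightarrow> p \<noteq> 0"
proof
  assume "num p q dvd 1"
  then obtain x where "1 = num p q * x"
    by (rule dvdE)
  moreover obtain r s where "x = num r s"
    using num_surj by blast
  ultimately have "num 1 0 = num (p * r) (p * s + q * r)"
    by (simp add: num_mult num_one)
  then show "p \<noteq> 0"
    by (auto simp: num_eq_iff)
next
  assume "p \<noteq> 0"
  then have "num p q * num (1 / p) (- q / p\<^sup>2) = num 1 0"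
    by (simp add: num_mult num_eq_iff power2_eq_square field_simps)
  then show "num p q dvd 1"
    by (metis dvdI num_one)
qed

text \<open>The lattices with a triangular basis, in the order \<open>1\<close>-coordinate of the first vector,
  \<open>a\<close>-coordinate of the first vector, \<open>a\<close>-coordinate of the second vector.\<close>

definition lat :: "rat \<Rightarrow> rat \<Rightarrow> rat \<Rightarrow> 'a set" where
  "lat p r q = int_span {num p r, num 0 q}"

lemma num_mem_lat:
  "num x y \<in> lat p r q \<longleftrightarrow> (\<exists>m n :: int. x = of_int m * p \<and> y = of_int m * r + of_int n * q)"
  by (simp add: lat_def int_mod.span_pair int_scale_num num_add num_eq_iff)

abbreviation ord_lat :: "rat \<Rightarrow> 'a set" where
  "ord_lat \<alpha> \<equiv> int_span {1, smul \<alpha> a}"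

lemma ord_lat: "ord_lat \<alpha> = lat 1 0 \<alpha>"
  by (simp add: lat_def num_one num_smul_a)

lemma num_mem_ord_lat:
  "num x y \<in> ord_lat \<alpha> \<longleftrightarrow> (\<exists>m n :: int. x = of_int m \<and> y = of_int n * \<alpha>)"
  by (simp add: ord_lat num_mem_lat)

lemma set_eq_num: "A = B \<longleftrightarrow> (\<forall>x y. num x y \<in> A \<longleftrightarrow> num x y \<in> B)"
proof
  assume *: "\<forall>x y. num x y \<in> A \<longleftrightarrow> num x y \<in> B"
  show "A = B"
  proof (rule set_eqI)
    fix z
    obtain x y where "z = num x y"
      using num_surj by blast
    then show "z \<in> A \<longleftrightarrow> z \<in> B"
      using * by simp
  qed
qed simp

lemma lat_full:
  assumes "p \<noteq> 0" "q \<noteq> 0"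
  shows "lat p r q \<in> full_lattices smul"
proof -
  have "fin_gen_int (lat p r q)"
    unfolding fin_gen_int_def lat_def by (rule exI[of _ "{num p r, num 0 q}"]) simp
  moreover have "z \<in> span (lat p r q)" for z
  proof -
    obtain x y where z: "z = num x y"
      using num_surj by blast
    have "z = smul (x / p) (num p r) + smul ((y - x / p * r) / q) (num 0 q)"
      using assms by (simp add: z smul_num num_add num_eq_iff)
    moreover have "num p r \<in> lat p r q" "num 0 q \<in> lat p r q"
      unfolding lat_def by (simp_all add: int_mod.span_base)
    ultimately show ?thesis
      by (simp add: span_add span_scale span_base)
  qed
  ultimately show ?thesis
    by (auto simp: full_lattices_def)
qed

lemma lat_basis:
  assumes "p \<noteq> 0" "q \<noteq> 0"
  shows "tuple_basis int_scale (vector [num p r, num 0 q] :: 'a^2) (lat p r q)"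
  using assms
  by (auto simp: int_mod.tuple_basis_2_iff lat_def int_scale_num num_add num_eq_iff simp flip: num_zero)

text \<open>Subtracting a multiple of the second basis vector from the first one; this is the only freedom
  in the choice of a positive triangular basis.\<close>

lemma lat_shift: "lat p (r - of_int k * q) q = lat p r q"
proof -
  have "(\<exists>n::int. y = of_int m * (r - of_int k * q) + of_int n * q) \<longleftrightarrow>
    (\<exists>n::int. y = of_int m * r + of_int n * q)" for y and m :: int
  proof
    assume "\<exists>n::int. y = of_int m * (r - of_int k * q) + of_int n * q"
    then obtain n :: int where "y = of_int m * (r - of_int k * q) + of_int n * q"
      by blast
    then have "y = of_int m * r + of_int (n - m * k) * q"
      by (simp add: algebra_simps)
    then show "\<exists>n::int. y = of_int m * r + of_int n * q"
      by blast
  next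
    assume "\<exists>n::int. y = of_int m * r + of_int n * q"
    then obtain n :: int where "y = of_int m * r + of_int n * q"
      by blast
    then have "y = of_int m * (r - of_int k * q) + of_int (n + m * k) * q"
      by (simp add: algebra_simps)
    then show "\<exists>n::int. y = of_int m * (r - of_int k * q) + of_int n * q"
      by blast
  qed
  then show ?thesis
    by (simp add: set_eq_num num_mem_lat)
qed

text \<open>The parameter \<open>p\<close> is recovered as the positive generator of the first coordinates, and \<open>q\<close> as
  that of the intersection with \<open>\<rat> a\<close>; then \<open>r\<close> is determined modulo \<open>q\<close>.\<close>

lemma lat_eq_imp:
  assumes pos: "0 < p" "0 < q" "0 < p'" "0 < q'" and eq: "lat p r q = lat p' r' q'"
  shows "p = p' \<and> q = q' \<and> (\<exists>n::int. r = r' + of_int n * q')"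
proof -
  have fst: "int_span {p} = {x. \<exists>y. num x y \<in> lat p r q}" for p r q
    by (auto simp: int_mod.span_singleton num_mem_lat)
  have snd: "int_span {q} = {y. num 0 y \<in> lat p r q}" if "0 < p" for p r q
    using that by (auto simp: int_mod.span_singleton num_mem_lat)
  have "int_span {p} = int_span {p'}" "int_span {q} = int_span {q'}"
    using fst[of p r q] fst[of p' r' q'] snd[of p q r] snd[of p' q' r'] pos eq by simp_all
  then have pq: "p = p'" "q = q'"
    using pos by (simp_all add: int_span_rat_eq_iff)
  have "num p r \<in> lat p' r' q'"
    unfolding eq[symmetric] by (simp add: lat_def int_mod.span_base)
  then obtain m n :: int where "p = of_int m * p'" "r = of_int m * r' + of_int n * q'"
    by (auto simp: num_mem_lat)
  moreover from this have "of_int m = (1::rat)"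
    using pq pos by simp
  ultimately show ?thesis
    using pq by auto
qed

text \<open>As \<open>a\<^sup>2 = 0\<close>, the unit \<open>c + d a\<close> acts on multiples of \<open>a\<close> as the scalar \<open>c\<close>. Read from right to
  left this factors a triangular lattice into a unit and an order.\<close>

lemma scaled_ord_lat:
  assumes "c \<noteq> 0"
  shows "(*) (num c d) ` ord_lat \<alpha> = lat c d (c * \<alpha>)"
  using assms num_mult[of c d 1 0] num_mult[of c d 0 \<alpha>]
  by (simp add: lat_def image_mult_int_span_pair num_one num_smul_a)


text \<open>A subgroup of \<open>\<rat>\<close> with bounded denominators is cyclic. This applies both to the first
  coordinates of \<open>L\<close> and to \<open>L \<inter> \<rat> a\<close>, for which the generators of \<open>L\<close> do not directly give
  generators.\<close>

lemma lattice_denominators: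
  assumes "fin_gen_int L"
  shows "\<exists>N>0. \<forall>p q. num p q \<in> L \<longrightarrow> of_int N * p \<in> \<int> \<and> of_int N * q \<in> \<int>"
proof -
  obtain B where B: "finite B" "L = int_span B"
    using assms by (auto simp: fin_gen_int_def)
  obtain f g where fg: "\<And>x. x = num (f x) (g x)"
    using num_surj by metis
  have f: "f (num p q) = p" and g: "g (num p q) = q" for p q
    using fg[of "num p q"] by (simp_all add: num_eq_iff)
  obtain N where N: "N > 0" "\<forall>x\<in>f ` B \<union> g ` B. of_int N * x \<in> \<int>"
    using rat_common_denominator[of "f ` B \<union> g ` B"] B(1) by blast
  have "of_int N * f x \<in> \<int> \<and> of_int N * g x \<in> \<int>" if "x \<in> L" for x
    using that unfolding B(2)
  proof (induction rule: int_mod.span_induct_alt)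
    case base
    then show ?case
      using f[of 0 0] g[of 0 0] by (simp add: num_zero)
  next
    case (step c x y)
    have "of_int c * x + y = num (of_int c * f x + f y) (of_int c * g x + g y)"
      by (subst fg[of x], subst fg[of y]) (simp only: int_scale_num num_add)
    then have *: "f (of_int c * x + y) = of_int c * f x + f y" "g (of_int c * x + y) = of_int c * g x + g y"
      by (simp_all add: f g)
    have "of_int N * f x \<in> \<int>" "of_int N * g x \<in> \<int>"
      using N(2) step(1) by blast+
    then have "of_int c * (of_int N * f x) + of_int N * f y \<in> \<int>"
      "of_int c * (of_int N * g x) + of_int N * g y \<in> \<int>"
      using step(2) Ints_add[OF Ints_mult[OF Ints_of_int]] by blast+
    then show ?case
      unfolding * by (simp only: distrib_left mult.left_commute)
  qed
  then show ?thesis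
    using N(1) f g by metis
qed

text \<open>Here \<open>p\<close> generates the group of first coordinates of \<open>L\<close>, \<open>q\<close> the group of those \<open>y\<close> with
  \<open>y a \<in> L\<close>, and \<open>p + r a\<close> is any element of \<open>L\<close> with first coordinate \<open>p\<close>. Fullness enters only
  to exclude \<open>p = 0\<close> and \<open>q = 0\<close>.\<close>

lemma full_lattice_form:
  assumes "L \<in> full_lattices smul"
  shows "\<exists>p r q. 0 < p \<and> 0 < q \<and> L = lat p r q"
proof -
  have fin: "fin_gen_int L" and spn: "span L = UNIV"
    using assms by (auto simp: full_lattices_def)
  obtain B where B: "L = int_span B"
    using fin by (auto simp: fin_gen_int_def)
  have zero: "num 0 0 \<in> L"
    unfolding num_zero B by (rule int_mod.span_zero)
  have diff: "x - y \<in> L" and add: "x + y \<in> L" if "x \<in> L" "y \<in> L" for x y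
    using that unfolding B by (auto intro: int_mod.span_diff int_mod.span_add)
  have scale: "of_int n * x \<in> L" if "x \<in> L" for n x
    using that unfolding B by (rule int_mod.span_scale)
  obtain N where N: "N > 0" "\<And>p q. num p q \<in> L \<Longrightarrow> of_int N * p \<in> \<int>"
    "\<And>p q. num p q \<in> L \<Longrightarrow> of_int N * q \<in> \<int>"
    using lattice_denominators[OF fin] by blast
  have "\<exists>p\<ge>0. {p. \<exists>q. num p q \<in> L} = int_span {p}"
  proof (rule rat_subgroup_cyclic)
    show "x - y \<in> {p. \<exists>q. num p q \<in> L}"
      if xy: "x \<in> {p. \<exists>q. num p q \<in> L}" "y \<in> {p. \<exists>q. num p q \<in> L}" for x y
    proof -
      obtain x' y' where "num x x' \<in> L" "num y y' \<in> L"
        using xy by blast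
      then have "num (x - y) (x' - y') \<in> L"
        using diff by (simp flip: num_diff)
      then show ?thesis
        by blast
    qed
  qed (use zero N in blast)+
  then obtain p where p: "0 \<le> p" "{p. \<exists>q. num p q \<in> L} = int_span {p}"
    by blast
  have "\<exists>q\<ge>0. {q. num 0 q \<in> L} = int_span {q}"
  proof (rule rat_subgroup_cyclic)
    show "x - y \<in> {q. num 0 q \<in> L}" if xy: "x \<in> {q. num 0 q \<in> L}" "y \<in> {q. num 0 q \<in> L}" for x y
      using diff[of "num 0 x" "num 0 y"] xy by (simp add: num_diff)
  qed (use zero N in blast)+
  then obtain q where q: "0 \<le> q" "{q. num 0 q \<in> L} = int_span {q}"
    by blast
  have "p \<in> {p. \<exists>q. num p q \<in> L}"
    unfolding p(2) by (simp add: int_mod.span_base)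
  then obtain r where pr: "num p r \<in> L"
    by blast
  have "q \<in> {q. num 0 q \<in> L}"
    unfolding q(2) by (simp add: int_mod.span_base)
  then have q0: "num 0 q \<in> L"
    by blast
  have "num x y \<in> L \<longleftrightarrow> num x y \<in> lat p r q" for x y
  proof
    assume xy: "num x y \<in> L"
    then have "x \<in> int_span {p}"
      unfolding p(2)[symmetric] by blast
    then obtain m :: int where m: "x = of_int m * p"
      unfolding int_mod.span_singleton by blast
    have "num x y - of_int m * num p r \<in> L"
      by (rule diff[OF xy scale[OF pr]])
    then have "num 0 (y - of_int m * r) \<in> L"
      by (simp add: int_scale_num num_diff m)
    then have "y - of_int m * r \<in> int_span {q}"
      unfolding q(2)[symmetric] by blast
    then obtain n :: int where n: "y - of_int m * r = of_int n * q"
      unfolding int_mod.span_singleton by blast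
    then have "y = of_int m * r + of_int n * q"
      by (simp add: algebra_simps)
    then show "num x y \<in> lat p r q"
      using m unfolding num_mem_lat by blast
  next
    assume "num x y \<in> lat p r q"
    then obtain m n :: int where "x = of_int m * p" "y = of_int m * r + of_int n * q"
      unfolding num_mem_lat by blast
    then have "num x y = of_int m * num p r + of_int n * num 0 q"
      by (simp add: int_scale_num num_add)
    then show "num x y \<in> L"
      using add scale pr q0 by simp
  qed
  then have L: "L = lat p r q"
    unfolding set_eq_num by blast
  have sub: "subspace (range (\<lambda>c. smul c (num x y)))" for x y
    by (simp add: subspace_span flip: span_singleton)
  \<comment> \<open>A degenerate generator would put \<open>L\<close> on a line through the origin.\<close>
  have line: "L \<subseteq> range (\<lambda>c. smul c (num x y)) \<Longrightarrow> False" for x y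
  proof -
    assume "L \<subseteq> range (\<lambda>c. smul c (num x y))"
    then have "span L \<subseteq> range (\<lambda>c. smul c (num x y))"
      using sub by (rule span_minimal)
    then have "num 1 0 \<in> range (\<lambda>c. smul c (num x y))" "num 0 1 \<in> range (\<lambda>c. smul c (num x y))"
      unfolding spn by blast+
    then show False
      by (auto simp: smul_num num_eq_iff)
  qed
  have "p \<noteq> 0"
  proof
    assume "p = 0"
    then have "z \<in> range (\<lambda>c. smul c (num 0 1))" if z: "z \<in> L" for z
    proof -
      obtain m n :: int where "z = of_int m * num p r + of_int n * num 0 q"
        using z unfolding L lat_def int_mod.span_pair by blast
      then have "z = smul (of_int m * r + of_int n * q) (num 0 1)"
        using \<open>p = 0\<close> by (simp add: int_scale_num smul_num num_add)
      then show ?thesis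
        by blast
    qed
    then show False
      using line[of 0 1] by blast
  qed
  moreover have "q \<noteq> 0"
  proof
    assume "q = 0"
    then have "z \<in> range (\<lambda>c. smul c (num p r))" if z: "z \<in> L" for z
    proof -
      obtain m n :: int where "z = of_int m * num p r + of_int n * num 0 q"
        using z unfolding L lat_def int_mod.span_pair by blast
      then have "z = smul (of_int m) (num p r)"
        using \<open>q = 0\<close> by (simp add: int_scale_num smul_num num_add)
      then show ?thesis
        by blast
    qed
    then show False
      using line[of p r] by blast
  qed
  ultimately show ?thesis
    using L p(1) q(1) by (intro exI[of _ p] exI[of _ r] exI[of _ q]) simp
qed

lemma full_lattice_unit_times_order:
  assumes "L \<in> full_lattices smul"
  shows "\<exists>u \<alpha>. u dvd 1 \<and> 0 < \<alpha> \<and> L = (*) u ` ord_lat \<alpha>"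
proof -
  obtain p r q where L: "0 < p" "0 < q" "L = lat p r q"
    using full_lattice_form[OF assms] by blast
  then have "L = (*) (num p r) ` ord_lat (q / p)"
    by (simp add: scaled_ord_lat)
  moreover have "num p r dvd 1" "0 < q / p"
    using L by (simp_all add: num_unit_iff)
  ultimately show ?thesis
    by blast
qed

lemma unit_times_order_full:
  assumes "u dvd 1" "0 < \<alpha>"
  shows "(*) u ` ord_lat \<alpha> \<in> full_lattices smul"
proof -
  obtain p r where u: "u = num p r"
    using num_surj by blast
  then have "p \<noteq> 0"
    using assms by (simp add: num_unit_iff)
  then show ?thesis
    using assms by (simp add: u scaled_ord_lat lat_full)
qed

lemma ord_lat_full: "0 < \<alpha> \<Longrightarrow> ord_lat \<alpha> \<in> full_lattices smul"
  unfolding ord_lat by (rule lat_full) simp_all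

text \<open>Since \<open>a\<^sup>2 = 0\<close>, the product of \<open>m + k \<alpha> a\<close> and \<open>m' + l \<beta> a\<close> has second coordinate in
  \<open>\<int> \<alpha> + \<int> \<beta>\<close>. Conversely \<open>m + (k \<alpha> + l \<beta>) a = (m + k \<alpha> a) 1 + 1 (l \<beta> a)\<close> is a sum of two
  products.\<close>

lemma lattice_mult_ord_lat:
  assumes "0 < \<alpha>" "0 < \<beta>"
  shows "lattice_mult (ord_lat \<alpha>) (ord_lat \<beta>) = ord_lat (gcd_rat \<alpha> \<beta>)"
proof
  let ?g = "gcd_rat \<alpha> \<beta>"
  have g: "int_span {?g} = int_span {\<alpha>, \<beta>}"
    using assms by (rule int_span_gcd_rat)
  have multiple: "(\<exists>n :: int. y = of_int n * ?g) \<longleftrightarrow> (\<exists>k l :: int. y = of_int k * \<alpha> + of_int l * \<beta>)" for y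
  proof -
    have "y \<in> int_span {?g} \<longleftrightarrow> y \<in> int_span {\<alpha>, \<beta>}"
      by (simp only: g)
    then show ?thesis
      unfolding int_mod.span_singleton int_mod.span_pair by blast
  qed
  show "lattice_mult (ord_lat \<alpha>) (ord_lat \<beta>) \<subseteq> ord_lat ?g"
  proof (rule lattice_mult_subset)
    fix z w
    assume z: "z \<in> ord_lat \<alpha>" and w: "w \<in> ord_lat \<beta>"
    obtain x y x' y' where zw: "z = num x y" "w = num x' y'"
      using num_surj by metis
    obtain m k :: int where 1: "x = of_int m" "y = of_int k * \<alpha>"
      using z unfolding zw num_mem_ord_lat by blast
    obtain m' l :: int where 2: "x' = of_int m'" "y' = of_int l * \<beta>"
      using w unfolding zw num_mem_ord_lat by blast
    have "x * y' + y * x' = of_int (k * m') * \<alpha> + of_int (m * l) * \<beta>"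
      by (simp add: 1 2)
    then have "\<exists>n :: int. x * y' + y * x' = of_int n * ?g"
      unfolding multiple by blast
    moreover have "x * x' = of_int (m * m')"
      by (simp add: 1 2)
    ultimately show "z * w \<in> ord_lat ?g"
      unfolding zw num_mult num_mem_ord_lat by blast
  qed (auto intro: int_mod.span_zero int_mod.span_add)
  show "ord_lat ?g \<subseteq> lattice_mult (ord_lat \<alpha>) (ord_lat \<beta>)"
  proof
    fix z
    assume z: "z \<in> ord_lat ?g"
    obtain x y where xy: "z = num x y"
      using num_surj by blast
    obtain m n :: int where mn: "x = of_int m" "y = of_int n * ?g"
      using z unfolding xy num_mem_ord_lat by blast
    then obtain k l :: int where kl: "y = of_int k * \<alpha> + of_int l * \<beta>"
      using multiple by blast
    have "num (of_int m) (of_int k * \<alpha>) \<in> ord_lat \<alpha>" "num 1 0 \<in> ord_lat \<beta>"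
      "num 1 0 \<in> ord_lat \<alpha>" "num 0 (of_int l * \<beta>) \<in> ord_lat \<beta>"
      unfolding num_mem_ord_lat
      by (rule exI[of _ m] exI[of _ 1] exI[of _ 0], (rule exI[of _ k] exI[of _ l] exI[of _ 0]), simp)+
    then have "num (of_int m) (of_int k * \<alpha>) * num 1 0 + num 1 0 * num 0 (of_int l * \<beta>) \<in>
        lattice_mult (ord_lat \<alpha>) (ord_lat \<beta>)"
      by (rule lattice_mult_two_products)
    then show "z \<in> lattice_mult (ord_lat \<alpha>) (ord_lat \<beta>)"
      by (simp add: num_mult num_add xy mn(1) kl)
  qed
qed

lemma gcd_rat_self: "0 < \<alpha> \<Longrightarrow> gcd_rat \<alpha> \<alpha> = \<alpha>"
  by (rule gcd_rat_unique) simp_all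

lemma ord_lat_order:
  assumes "0 < \<alpha>"
  shows "ord_lat \<alpha> \<in> orders smul"
  using assms by (simp add: orders_def ord_lat_full lattice_mult_ord_lat gcd_rat_self int_mod.span_base)

lemma order_of_unit_times_order:
  assumes "u dvd 1" "0 < \<alpha>"
  shows "order_of ((*) u ` ord_lat \<alpha>) = ord_lat \<alpha>"
  using assms by (simp add: order_of_unit_mult order_of_order[OF ord_lat_order])


section \<open>Classification of orders and \<open>\<epsilon>\<close>-classes\<close>

text \<open>An order \<open>\<Lambda> = u (\<int> + \<int> \<alpha> a)\<close> equals its multiplier ring, which is \<open>\<int> + \<int> \<alpha> a\<close>.\<close>

lemma orders_eq: "orders smul = {ord_lat \<alpha> | \<alpha>. 0 < \<alpha>}"
proof
  show "orders smul \<subseteq> {ord_lat \<alpha> | \<alpha>. 0 < \<alpha>}"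
  proof
    fix \<Lambda>
    assume \<Lambda>: "\<Lambda> \<in> orders smul"
    then have "\<Lambda> \<in> full_lattices smul"
      by (simp add: orders_def)
    then obtain u \<alpha> where u: "u dvd 1" "0 < \<alpha>" "\<Lambda> = (*) u ` ord_lat \<alpha>"
      using full_lattice_unit_times_order by blast
    then have "\<Lambda> = ord_lat \<alpha>"
      using order_of_order[OF \<Lambda>] order_of_unit_times_order by simp
    then show "\<Lambda> \<in> {ord_lat \<alpha> | \<alpha>. 0 < \<alpha>}"
      using u by blast
  qed
qed (auto intro: ord_lat_order)

lemma ord_lat_eq_iff:
  assumes "0 < \<alpha>" "0 < \<beta>"
  shows "ord_lat \<alpha> = ord_lat \<beta> \<longleftrightarrow> \<alpha> = \<beta>"
  using assms lat_eq_imp[of 1 \<alpha> 1 \<beta> 0 0] by (auto simp: ord_lat)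

lemma orders_iso: "semigroup_iso ord_lat {q. 0 < q} gcd_rat (orders smul) lattice_mult"
proof (rule semigroup_isoI[OF comm_semigroup_gcd_rat])
  show "bij_betw ord_lat {q. 0 < q} (orders smul)"
    by (auto simp: bij_betw_def inj_on_def ord_lat_eq_iff orders_eq)
qed (simp add: lattice_mult_ord_lat)

text \<open>The union defining the product is constant: different representatives change
  \<open>lattice_mult L M\<close> by a unit only.\<close>

lemma eps_mult_eps_class:
  assumes pos: "0 < \<alpha>" "0 < \<beta>"
  shows "eps_mult smul (eps_class smul (ord_lat \<alpha>)) (eps_class smul (ord_lat \<beta>)) =
    eps_class smul (ord_lat (gcd_rat \<alpha> \<beta>))"
proof -
  have "eps_class smul (lattice_mult L M) = eps_class smul (ord_lat (gcd_rat \<alpha> \<beta>))"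
    if LM: "L \<in> eps_class smul (ord_lat \<alpha>)" "M \<in> eps_class smul (ord_lat \<beta>)" for L M
  proof -
    obtain u v where uv: "u dvd 1" "v dvd 1" "L = (*) u ` ord_lat \<alpha>" "M = (*) v ` ord_lat \<beta>"
      using LM unfolding mem_eps_class_iff by blast
    have "lattice_mult L M = (*) (u * v) ` ord_lat (gcd_rat \<alpha> \<beta>)"
      unfolding uv lattice_mult_scaled lattice_mult_ord_lat[OF pos] ..
    moreover have "u * v dvd 1"
      using mult_dvd_mono[OF uv(1,2)] by simp
    moreover have "0 < gcd_rat \<alpha> \<beta>"
      using pos by (rule gcd_rat_pos)
    ultimately show ?thesis
      using ord_lat_full unit_times_order_full
      by (intro eps_class_eq) (auto simp: mem_eps_class_iff)
  qed
  moreover have "ord_lat \<alpha> \<in> eps_class smul (ord_lat \<alpha>)" "ord_lat \<beta> \<in> eps_class smul (ord_lat \<beta>)"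
    using pos by (simp_all add: eps_class_self ord_lat_full)
  ultimately show ?thesis
    unfolding eps_mult_def by blast
qed

lemma eps_classes_iso:
  "semigroup_iso (\<lambda>\<alpha>. eps_class smul (ord_lat \<alpha>)) {q. 0 < q} gcd_rat (eps_classes smul) (eps_mult smul)"
proof (rule semigroup_isoI[OF comm_semigroup_gcd_rat])
  let ?h = "\<lambda>\<alpha>. eps_class smul (ord_lat \<alpha>)"
  have "inj_on ?h {q. 0 < q}"
  proof (rule inj_onI)
    fix \<alpha> \<beta>
    assume "\<alpha> \<in> {q. 0 < q}" "\<beta> \<in> {q. 0 < q}" and eq: "?h \<alpha> = ?h \<beta>"
    then have pos: "0 < \<alpha>" "0 < \<beta>"
      by simp_all
    then have "ord_lat \<alpha> \<in> ?h \<beta>"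
      unfolding eq[symmetric] by (simp add: eps_class_self ord_lat_full)
    then have "ord_lat \<alpha> = ord_lat \<beta>"
      using order_in_eps_class[OF ord_lat_order] order_of_order[OF ord_lat_order] pos by metis
    then show "\<alpha> = \<beta>"
      using pos by (simp add: ord_lat_eq_iff)
  qed
  moreover have "eps_classes smul \<subseteq> ?h ` {q. 0 < q}"
  proof
    fix C
    assume "C \<in> eps_classes smul"
    then obtain L where L: "L \<in> full_lattices smul" "C = eps_class smul L"
      unfolding eps_classes_def eps_class_def by (rule quotientE)
    then obtain u \<alpha> where u: "u dvd 1" "0 < \<alpha>" "L = (*) u ` ord_lat \<alpha>"
      using full_lattice_unit_times_order by blast
    then have "L \<in> ?h \<alpha>"
      using L ord_lat_full unfolding mem_eps_class_iff by blast
    then have "C = ?h \<alpha>"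
      using L eps_class_eq by blast
    then show "C \<in> ?h ` {q. 0 < q}"
      using u by blast
  qed
  moreover have "?h ` {q. 0 < q} \<subseteq> eps_classes smul"
    by (auto intro: eps_class_in_eps_classes ord_lat_full)
  ultimately show "bij_betw ?h {q. 0 < q} (eps_classes smul)"
    unfolding bij_betw_def by blast
qed (simp add: eps_mult_eps_class)


section \<open>Triangular bases\<close>

lemma triangular_tuple:
  "tuple_mult smul (vector [1, a] :: 'a^2) (vector [vector [p, 0], vector [r, q]] :: rat^2^2) =
    vector [num p r, num 0 q]"
  by (simp add: vec_eq_iff forall_2 tuple_mult_def sum_2 num_def)

lemma triangular_basis:
  assumes "tuple_basis int_scale
    (tuple_mult smul (vector [1, a] :: 'a^2) (vector [vector [p, 0], vector [r, q]] :: rat^2^2)) L"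
  shows "L = lat p r q"
  using assms by (simp add: triangular_tuple int_mod.tuple_basis_2_iff lat_def)

text \<open>Existence rounds the off-diagonal entry into the half-open interval of length \<open>\<beta>22\<close>; uniqueness
  holds because that interval contains one representative of each class modulo \<open>\<beta>22\<close>.\<close>

lemma ex1_triangular_basis:
  assumes "L \<in> full_lattices smul"
  shows "\<exists>!v::'a^2. tuple_basis int_scale v L \<and>
    (\<exists>\<beta>11 \<beta>21 \<beta>22. 0 < \<beta>11 \<and> 0 < \<beta>22 \<and> \<beta>21 \<in> {- (1/2) * \<beta>22 <.. (1/2) * \<beta>22} \<and>
      v = tuple_mult smul (vector [1, a] :: 'a^2)
        (vector [vector [\<beta>11, 0], vector [\<beta>21, \<beta>22]] :: rat^2^2))"
proof -
  obtain p r0 q where L: "0 < p" "0 < q" "L = lat p r0 q"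
    using full_lattice_form[OF assms] by blast
  \<comment> \<open>The ceiling, not the floor, because the interval is closed on the right.\<close>
  define r where "r = r0 - of_int \<lceil>r0 / q - 1 / 2\<rceil> * q"
  have Lr: "L = lat p r q"
    unfolding r_def lat_shift L(3) ..
  have "r0 / q - 1 / 2 \<le> of_int \<lceil>r0 / q - 1 / 2\<rceil>" "of_int \<lceil>r0 / q - 1 / 2\<rceil> < r0 / q - 1 / 2 + 1"
    using ceiling_correct[of "r0 / q - 1 / 2"] by linarith+
  then have "(r0 / q - 1 / 2) * q \<le> of_int \<lceil>r0 / q - 1 / 2\<rceil> * q"
    "of_int \<lceil>r0 / q - 1 / 2\<rceil> * q < (r0 / q - 1 / 2 + 1) * q"
    using L(2) by (simp_all only: mult_le_cancel_right_pos mult_less_cancel_right_pos)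
  moreover have "(r0 / q - 1 / 2) * q = r0 - q / 2" "(r0 / q - 1 / 2 + 1) * q = r0 + q / 2"
    using L(2) by (simp_all add: field_simps)
  ultimately have r: "r \<in> {- (1/2) * q <.. (1/2) * q}"
    unfolding r_def by auto
  show ?thesis
  proof (rule ex1I)
    show "tuple_basis int_scale (vector [num p r, num 0 q] :: 'a^2) L \<and>
      (\<exists>\<beta>11 \<beta>21 \<beta>22. 0 < \<beta>11 \<and> 0 < \<beta>22 \<and> \<beta>21 \<in> {- (1/2) * \<beta>22 <.. (1/2) * \<beta>22} \<and>
        vector [num p r, num 0 q] = tuple_mult smul (vector [1, a] :: 'a^2)
          (vector [vector [\<beta>11, 0], vector [\<beta>21, \<beta>22]] :: rat^2^2))"
      using L(1,2) r lat_basis[of p q r] unfolding Lr triangular_tuple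
      by (intro conjI exI[of _ p] exI[of _ r] exI[of _ q]) simp_all
  next
    fix v :: "'a^2"
    assume "tuple_basis int_scale v L \<and>
      (\<exists>\<beta>11 \<beta>21 \<beta>22. 0 < \<beta>11 \<and> 0 < \<beta>22 \<and> \<beta>21 \<in> {- (1/2) * \<beta>22 <.. (1/2) * \<beta>22} \<and>
        v = tuple_mult smul (vector [1, a] :: 'a^2)
          (vector [vector [\<beta>11, 0], vector [\<beta>21, \<beta>22]] :: rat^2^2))"
    then obtain p' r' q' where v: "0 < p'" "0 < q'" "r' \<in> {- (1/2) * q' <.. (1/2) * q'}"
      "v = tuple_mult smul (vector [1, a] :: 'a^2) (vector [vector [p', 0], vector [r', q']] :: rat^2^2)"
      "tuple_basis int_scale v L"
      by blast
    have "lat p r q = lat p' r' q'"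
      using triangular_basis[of p' r' q' L] v(4,5) Lr by simp
    then obtain n :: int where n: "p = p'" "q = q'" "r = r' + of_int n * q'"
      using lat_eq_imp[of p q p' q' r r'] L(1,2) v(1,2) by blast
    have "- (q' / 2) < r" "r \<le> q' / 2" "- (q' / 2) < r'" "r' \<le> q' / 2"
      using r v(3) n(2) by auto
    then have "of_int n * q' < 1 * q'" "- 1 * q' < of_int n * q'"
      using n(3) by linarith+
    then have "of_int n < (1::rat)" "- 1 < (of_int n :: rat)"
      using v(2) by (simp_all only: mult_less_cancel_right_pos)
    then have "n = 0"
      by linarith
    then show "v = vector [num p r, num 0 q]"
      using n v(4) by (simp add: triangular_tuple)
  qed
qed

text \<open>Everything follows from \<open>L = (p + r a) (\<int> + \<int> (q / p) a)\<close>. Invertibility uses that orders are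
  idempotent: the inverse unit times the order is a partner \<open>b\<close> for which \<open>L b\<close> is the order, and the
  order times \<open>L\<close> is \<open>L\<close>.\<close>

lemma triangular_basis_invariants:
  assumes pos: "0 < p" "0 < q" and L: "L = lat p r q"
  shows "{\<Lambda> \<in> orders smul. \<Lambda> \<in> eps_class smul L} = {ord_lat (q / p)}"
    and "semigroup_invertible (full_lattices smul) lattice_mult L"
    and "order_of L = ord_lat (q / p)"
proof -
  have u: "num p r dvd 1" and \<alpha>: "0 < q / p"
    using pos by (simp_all add: num_unit_iff)
  have L': "L = (*) (num p r) ` ord_lat (q / p)"
    using pos by (simp add: L scaled_ord_lat)
  have full: "L \<in> full_lattices smul"
    unfolding L' using u \<alpha> by (rule unit_times_order_full)
  show order: "order_of L = ord_lat (q / p)"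
    unfolding L' using u \<alpha> by (rule order_of_unit_times_order)
  have "L \<in> eps_class smul (ord_lat (q / p))"
    unfolding mem_eps_class_iff using full u \<alpha> L' ord_lat_full by blast
  then have "eps_class smul L = eps_class smul (ord_lat (q / p))"
    by (rule eps_class_eq)
  then have "ord_lat (q / p) \<in> eps_class smul L"
    using \<alpha> by (simp add: eps_class_self ord_lat_full)
  then show "{\<Lambda> \<in> orders smul. \<Lambda> \<in> eps_class smul L} = {ord_lat (q / p)}"
    using order_in_eps_class order ord_lat_order[OF \<alpha>] by blast
  obtain v where v: "num p r * v = 1"
    using u by (metis dvdE)
  then have "v dvd 1"
    by (metis dvdI mult.commute)
  have idem: "lattice_mult (ord_lat (q / p)) (ord_lat (q / p)) = ord_lat (q / p)"
    using \<alpha> by (simp only: lattice_mult_ord_lat gcd_rat_self)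
  have "lattice_mult L ((*) v ` ord_lat (q / p)) = ord_lat (q / p)"
    unfolding L' lattice_mult_scaled idem v by simp
  moreover have "lattice_mult (ord_lat (q / p)) L = L"
    using lattice_mult_scaled[of 1 "ord_lat (q / p)" "num p r" "ord_lat (q / p)"] idem
    unfolding L' by simp
  moreover have "(*) v ` ord_lat (q / p) \<in> full_lattices smul"
    using \<open>v dvd 1\<close> \<alpha> by (rule unit_times_order_full)
  ultimately show "semigroup_invertible (full_lattices smul) lattice_mult L"
    using full ord_lat_full[OF \<alpha>] unfolding semigroup_invertible_def by blast
qed


section \<open>Orders containing \<open>a\<close> and nilpotent matrices\<close>

text \<open>The element \<open>a\<close> lies in \<open>\<int> + \<int> \<alpha> a\<close> exactly when \<open>1\<close> is an integer multiple of \<open>\<alpha>\<close>.\<close>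

lemma overorders_eq:
  "{\<Lambda> \<in> orders smul. int_span {1, a} \<subseteq> \<Lambda>} = {ord_lat (1 / of_nat m) | m::nat. 1 \<le> m}"
proof -
  have sub: "int_span {1, a} \<subseteq> ord_lat \<alpha> \<longleftrightarrow> (\<exists>m::nat. 1 \<le> m \<and> \<alpha> = 1 / of_nat m)"
    if \<alpha>: "0 < \<alpha>" for \<alpha>
  proof
    assume "int_span {1, a} \<subseteq> ord_lat \<alpha>"
    then have "num 0 1 \<in> ord_lat \<alpha>"
      using int_mod.span_base[of a "{1, a}"] by (auto simp: num_a)
    then obtain n :: int where n: "1 = of_int n * \<alpha>"
      unfolding num_mem_ord_lat by blast
    then have "0 < of_int n * \<alpha>"
      by simp
    then have "0 < n"
      using \<alpha> by (simp add: zero_less_mult_iff)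
    then have "1 \<le> nat n" "\<alpha> = 1 / of_nat (nat n)"
      using n by (simp_all add: field_simps)
    then show "\<exists>m::nat. 1 \<le> m \<and> \<alpha> = 1 / of_nat m"
      by blast
  next
    assume "\<exists>m::nat. 1 \<le> m \<and> \<alpha> = 1 / of_nat m"
    then obtain m :: nat where m: "1 \<le> m" "\<alpha> = 1 / of_nat m"
      by blast
    then have "(1::rat) = of_int (int m) * \<alpha>"
      by simp
    then have "num 0 1 \<in> ord_lat \<alpha>"
      unfolding num_mem_ord_lat by (metis of_int_0)
    then have "{1, a} \<subseteq> ord_lat \<alpha>"
      by (simp add: num_a int_mod.span_base)
    then show "int_span {1, a} \<subseteq> ord_lat \<alpha>"
      by (rule int_mod.span_minimal) (rule int_mod.subspace_span)
  qed
  show ?thesis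
  proof
    show "{\<Lambda> \<in> orders smul. int_span {1, a} \<subseteq> \<Lambda>} \<subseteq> {ord_lat (1 / of_nat m) | m::nat. 1 \<le> m}"
      unfolding orders_eq using sub by blast
    show "{ord_lat (1 / of_nat m) | m::nat. 1 \<le> m} \<subseteq> {\<Lambda> \<in> orders smul. int_span {1, a} \<subseteq> \<Lambda>}"
    proof
      fix \<Lambda>
      assume "\<Lambda> \<in> {ord_lat (1 / of_nat m) | m::nat. 1 \<le> m}"
      then obtain m :: nat where m: "1 \<le> m" "\<Lambda> = ord_lat (1 / of_nat m)"
        by blast
      then have "0 < (1 / of_nat m :: rat)"
        by simp
      then show "\<Lambda> \<in> {\<Lambda> \<in> orders smul. int_span {1, a} \<subseteq> \<Lambda>}"
        using m sub ord_lat_order by blast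
    qed
  qed
qed

lemma overorders_iso:
  "semigroup_isomorphic {\<Lambda> \<in> orders smul. int_span {1, a} \<subseteq> \<Lambda>} lattice_mult
    {1 / of_nat m | m::nat. 1 \<le> m} gcd_rat"
proof (rule semigroup_isomorphic_sym, rule semigroup_isomorphicI,
    rule semigroup_isoI[OF comm_semigroup_unit_fractions])
  have pos: "x \<in> {1 / of_nat m | m::nat. 1 \<le> m} \<Longrightarrow> 0 < x" for x :: rat
    by auto
  show "bij_betw ord_lat {1 / of_nat m | m::nat. 1 \<le> m} {\<Lambda> \<in> orders smul. int_span {1, a} \<subseteq> \<Lambda>}"
    unfolding bij_betw_def
  proof
    show "inj_on ord_lat {1 / of_nat m | m::nat. 1 \<le> m}"
      by (rule inj_onI) (use pos ord_lat_eq_iff in blast)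
    show "ord_lat ` {1 / of_nat m | m::nat. 1 \<le> m} = {\<Lambda> \<in> orders smul. int_span {1, a} \<subseteq> \<Lambda>}"
      unfolding overorders_eq by blast
  qed
  show "lattice_mult (ord_lat x) (ord_lat y) = ord_lat (gcd_rat x y)"
    if "x \<in> {1 / of_nat m | m::nat. 1 \<le> m}" "y \<in> {1 / of_nat m | m::nat. 1 \<le> m}" for x y
    using that pos by (simp only: lattice_mult_ord_lat)
qed

text \<open>In the basis \<open>u (a / m)\<close>, \<open>u\<close> of \<open>u (\<int> + \<int> (1 / m) a)\<close>, multiplication by \<open>a\<close> kills the first
  vector and sends the second one to \<open>m\<close> times the first.\<close>

lemma comes_from_ord_lat:
  assumes m: "1 \<le> (m::nat)"
  shows "comes_from smul a (conj_class (mat2 0 (int m) 0 0)) (eps_class smul (ord_lat (1 / of_nat m)))"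
proof -
  let ?\<alpha> = "1 / of_nat m :: rat"
  have \<alpha>: "0 < ?\<alpha>"
    using m by simp
  have ma: "of_nat m * smul ?\<alpha> a = a"
    using m int_scale_num[of "int m" 0 ?\<alpha>] by (simp add: num_smul_a num_a)
  have aa: "a * smul c a = 0" for c
    using num_mult[of 0 1 0 c] by (simp add: num_a num_smul_a num_zero)
  have "int_span {1, a} \<subseteq> order_of L \<and>
      conj_class (mat2 0 (int m) 0 0) = {M. \<exists>b::'a^2. tuple_basis int_scale b L \<and>
        (\<chi> j. a * b $ j) = tuple_mult int_scale b M}"
    if L: "L \<in> eps_class smul (ord_lat ?\<alpha>)" for L
  proof -
    obtain u where u: "u dvd 1" "L = (*) u ` ord_lat ?\<alpha>"
      using L unfolding mem_eps_class_iff by blast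
    let ?v = "vector [smul ?\<alpha> a, 1] :: 'a^2"
    have "tuple_basis int_scale ?v (ord_lat ?\<alpha>)"
      using m by (auto simp: int_mod.tuple_basis_2_iff insert_commute int_scale_num num_add num_eq_iff
          simp flip: num_smul_a num_zero num_one)
    then have b: "tuple_basis int_scale (\<chi> j. u * ?v $ j) L"
      unfolding u(2) by (rule tuple_basis_unit_mult[OF u(1)])
    have "(\<chi> j. a * (\<chi> j. u * ?v $ j) $ j) = tuple_mult int_scale (\<chi> j. u * ?v $ j) (mat2 0 (int m) 0 0)"
      using ma aa[of ?\<alpha>]
      by (simp add: vec_eq_iff forall_2 tuple_mult_def sum_2 mult.left_commute[of _ u] mult.commute[of a u])
    note matrices_of_mult_conj_class[OF b this]
    moreover have "int_span {1, a} \<subseteq> order_of L"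
      unfolding u(2) order_of_unit_times_order[OF u(1) \<alpha>]
      using overorders_eq m by blast
    ultimately show ?thesis
      by simp
  qed
  moreover have "eps_class smul (ord_lat ?\<alpha>) \<in> eps_classes smul"
    using \<alpha> by (intro eps_class_in_eps_classes ord_lat_full)
  ultimately show ?thesis
    unfolding comes_from_def by blast
qed

end


section \<open>The classification theorem\<close>

theorem theorem10p3:
  fixes smul :: "rat \<Rightarrow> 'a::comm_ring_1 \<Rightarrow> 'a" and a :: 'a
  assumes "rat_algebra smul"
    and "tuple_basis smul (vector [1, a] :: 'a^2) UNIV"
    and "a\<^sup>2 = 0"
  shows
    \<comment> \<open>(a)\<close>
    "orders smul = {int_span {1, smul \<alpha> a} | \<alpha>. 0 < \<alpha>}
     \<and>
     \<comment> \<open>(b)\<close>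
     (\<forall>L\<in>full_lattices smul.
        (\<exists>!v::'a^2. tuple_basis int_scale v L \<and>
           (\<exists>\<beta>11 \<beta>21 \<beta>22. 0 < \<beta>11 \<and> 0 < \<beta>22 \<and> \<beta>21 \<in> {- (1/2) * \<beta>22 <.. (1/2) * \<beta>22} \<and>
              v = tuple_mult smul (vector [1, a] :: 'a^2)
                    (vector [vector [\<beta>11, 0], vector [\<beta>21, \<beta>22]] :: rat^2^2))) \<and>
        (\<forall>\<beta>11 \<beta>21 \<beta>22. 0 < \<beta>11 \<and> 0 < \<beta>22 \<and> \<beta>21 \<in> {- (1/2) * \<beta>22 <.. (1/2) * \<beta>22} \<and>
           tuple_basis int_scale
             (tuple_mult smul (vector [1, a] :: 'a^2)
               (vector [vector [\<beta>11, 0], vector [\<beta>21, \<beta>22]] :: rat^2^2)) L \<longrightarrow>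
           {\<Lambda> \<in> orders smul. \<Lambda> \<in> eps_class smul L} = {int_span {1, smul (\<beta>22 / \<beta>11) a}} \<and>
           semigroup_invertible (full_lattices smul) lattice_mult L \<and>
           order_of L = int_span {1, smul (\<beta>22 / \<beta>11) a})) \<and>
     (\<forall>C\<in>w_classes (eps_classes smul) (eps_mult smul). is_singleton C) \<and>
     semigroup_isomorphic (eps_classes smul) (eps_mult smul) (orders smul) lattice_mult \<and>
     semigroup_isomorphic (orders smul) lattice_mult {q. 0 < q} gcd_rat \<and>
     semigroup_isomorphic {q. 0 < q} gcd_rat rat_lattices lattice_add
     \<and>
     \<comment> \<open>(c)\<close>
     {\<Lambda> \<in> orders smul. int_span {1, a} \<subseteq> \<Lambda>} =
       {int_span {1, smul (1 / of_nat m) a} | m::nat. 1 \<le> m} \<and>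
     semigroup_isomorphic {\<Lambda> \<in> orders smul. int_span {1, a} \<subseteq> \<Lambda>} lattice_mult
       {1 / of_nat m | m::nat. 1 \<le> m} gcd_rat \<and>
     (\<exists>h. semigroup_iso h {1 / of_nat m | m::nat. 1 \<le> m} gcd_rat {m::nat. 1 \<le> m} lcm \<and>
          (\<forall>m\<ge>1. h (1 / of_nat m) = m))
     \<and>
     \<comment> \<open>(d)\<close>
     (\<forall>C\<in>{conj_class M | M :: int^2^2. nilpotent_mat M \<and> M \<noteq> 0}.
        (\<exists>!N. N \<in> C \<and>
           (\<exists>m::nat. 1 \<le> m \<and> N = vector [vector [0, int m], vector [0, 0]])) \<and>
        (\<forall>m::nat. 1 \<le> m \<and> vector [vector [0, int m], vector [0, 0]] \<in> C \<longrightarrow>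
           comes_from smul a C (eps_class smul (int_span {1, smul (1 / of_nat m) a}))))"
proof -
  interpret dual_numbers smul a
    using assms by (simp add: dual_numbers_def dual_numbers_axioms_def)
  have b: "{\<Lambda> \<in> orders smul. \<Lambda> \<in> eps_class smul L} = {int_span {1, smul (\<beta>22 / \<beta>11) a}}"
      "semigroup_invertible (full_lattices smul) lattice_mult L"
      "order_of L = int_span {1, smul (\<beta>22 / \<beta>11) a}"
    if "0 < \<beta>11 \<and> 0 < \<beta>22 \<and> \<beta>21 \<in> {- (1/2) * \<beta>22 <.. (1/2) * \<beta>22} \<and>
      tuple_basis int_scale
        (tuple_mult smul (vector [1, a] :: 'a^2)
          (vector [vector [\<beta>11, 0], vector [\<beta>21, \<beta>22]] :: rat^2^2)) L" for L \<beta>11 \<beta>21 \<beta>22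
    using triangular_basis_invariants[of \<beta>11 \<beta>22 L \<beta>21] triangular_basis[of \<beta>11 \<beta>21 \<beta>22 L] that by blast+
  have w: "is_singleton C" if "C \<in> w_classes (eps_classes smul) (eps_mult smul)" for C
    by (rule w_classes_singleton_iso[OF eps_classes_iso _ that]) (use gcd_rat_antisym in blast)
  have iso: "semigroup_isomorphic (orders smul) lattice_mult {q. 0 < q} gcd_rat"
    by (rule semigroup_isomorphic_sym[OF semigroup_isomorphicI[OF orders_iso]])
  have eps: "semigroup_isomorphic (eps_classes smul) (eps_mult smul) (orders smul) lattice_mult"
    by (rule semigroup_isomorphic_trans[OF semigroup_isomorphic_sym[OF semigroup_isomorphicI[OF
            eps_classes_iso]] semigroup_isomorphicI[OF orders_iso]])
  have d1: "\<exists>!N. N \<in> C \<and> (\<exists>m::nat. 1 \<le> m \<and> N = mat2 0 (int m) 0 0)"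
    if "C \<in> {conj_class M | M :: int^2^2. nilpotent_mat M \<and> M \<noteq> 0}" for C
    using that nilpotent_mat2_normal_form by blast
  have d2: "comes_from smul a C (eps_class smul (int_span {1, smul (1 / of_nat m) a}))"
    if C: "C \<in> {conj_class M | M :: int^2^2. nilpotent_mat M \<and> M \<noteq> 0}"
      and m: "1 \<le> m \<and> mat2 0 (int m) 0 0 \<in> C" for C and m :: nat
  proof -
    have "C = conj_class (mat2 0 (int m) 0 0)"
      using C m conj_class_cong by blast
    then show ?thesis
      using comes_from_ord_lat m by blast
  qed
  show ?thesis
    by (intro conjI ballI allI impI;
        rule orders_eq ex1_triangular_basis b w eps iso rat_lattices_iso overorders_eq
          overorders_iso unit_fractions_lcm_iso d1 d2;
        assumption)
qed

end
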